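(* Let $H_1,H_2$ be infinite dimensional complex Hilbert spaces and let $T\in\mathcal{B}(H_1,H_2)$. Then the following are equivalent: (1) $T\in\mathcal{AM}(H_1,H_2)$, i.e. $T$ is absolutely minimum attaining; (2) there exists a decomposition of $T$ of the form $T=V(\alpha I-K+F)$, where $\alpha\ge 0$ is a real scalar, $K\in\mathcal{B}(H_1)$ is a positive compact operator with $\|K\|\le\alpha$, $F\in\mathcal{B}(H_1)$ is a positive finite rank operator satisfying $KF=FK=0$, and $V\in\mathcal{B}(H_1,H_2)$ is a partial isometry such that $N(V)=N(\alpha I-K+F)$. Moreover, this decomposition is unique: $V,\alpha,K,F$ with these properties are uniquely determined by $T$.
   Context: $\mathcal{B}(H_1,H_2)$ is the space of bounded linear operators from $H_1$ to $H_2$ and $\mathcal{B}(H)=\mathcal{B}(H,H)$ (Hilbert spaces are not assumed separable); $N(S)$ denotes the null space of $S$; $I$ is the identity on $H_1$. $S\in\mathcal{B}(H)$ is positive if $S=S^*$ and $\langle Sx,x\rangle\ge 0$ for all $x\in H$ (so the zero operator is positive). For a bounded operator $T:H_1\to H_2$ the minimum modulus is $m(T)=\inf\{\|Tx\|: x\in H_1,\ \|x\|=1\}$; $T$ is minimum attaining if there is $x_0\in H_1$ with $\|x_0\|=1$ and $\|Tx_0\|=m(T)$; $T$ is absolutely minimum attaining if the restriction $T|_M:M\to H_2$ is minimum attaining for every nonzero closed subspace $M$ of $H_1$. $\mathcal{AM}(H_1,H_2)$ is the set of absolutely minimum attaining operators in $\mathcal{B}(H_1,H_2)$. *)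

theory Defs
  imports "HOL-Analysis.Analysis"
begin

class complex_vector = real_vector +
  fixes scaleC :: "complex \<Rightarrow> 'a \<Rightarrow> 'a"  (infixr "*\<^sub>C" 75)
  assumes scaleC_add_right: "c *\<^sub>C (x + y) = c *\<^sub>C x + c *\<^sub>C y"
    and scaleC_add_left: "(c + d) *\<^sub>C x = c *\<^sub>C x + d *\<^sub>C x"
    and scaleC_scaleC: "c *\<^sub>C d *\<^sub>C x = (c * d) *\<^sub>C x"
    and scaleC_one: "1 *\<^sub>C x = x"
    and scaleR_scaleC: "r *\<^sub>R x = complex_of_real r *\<^sub>C x"

global_interpretation complex_vector:
  vector_space "scaleC :: complex \<Rightarrow> 'a \<Rightarrow> 'a::complex_vector"
  defines csubspace = complex_vector.subspace
    and cspan = complex_vector.span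
  by unfold_locales (rule scaleC_add_right scaleC_add_left scaleC_scaleC scaleC_one)+

(* The underlying real inner product is the real part of the complex one, so norm, metric and
   topology come from real_inner: norm x = sqrt (Re (cinner x x)).  Positive definiteness of
   cinner is the one of inner, since cinner_commute makes cinner x x real.
   cinner is linear in its first argument. *)
class complex_inner = complex_vector + real_inner +
  fixes cinner :: "'a \<Rightarrow> 'a \<Rightarrow> complex"
  assumes cinner_commute: "cinner x y = cnj (cinner y x)"
    and cinner_add_left: "cinner (x + y) z = cinner x z + cinner y z"
    and cinner_scaleC_left: "cinner (c *\<^sub>C x) y = c * cinner x y"
    and inner_eq_Re_cinner: "inner x y = Re (cinner x y)"

class chilbert_space = complex_inner + complete_space

instantiation complex :: chilbert_space
begin

definition scaleC_complex :: "complex \<Rightarrow> complex \<Rightarrow> complex"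
  where "scaleC_complex c x = c * x"

definition cinner_complex :: "complex \<Rightarrow> complex \<Rightarrow> complex"
  where "cinner_complex x y = x * cnj y"

instance
  by intro_classes
    (simp_all add: scaleC_complex_def cinner_complex_def algebra_simps scaleR_conv_of_real
      inner_complex_def)

end

definition cfinite_dim :: "'a::complex_vector set \<Rightarrow> bool"
  where "cfinite_dim W \<longleftrightarrow> (\<exists>B. finite B \<and> cspan B = W)"

definition bounded_clinear :: "('a::complex_inner \<Rightarrow> 'b::complex_inner) \<Rightarrow> bool"
  where "bounded_clinear f \<longleftrightarrow> bounded_linear f \<and> (\<forall>c x. f (c *\<^sub>C x) = c *\<^sub>C f x)"

definition null_space :: "('a::complex_inner \<Rightarrow> 'b::complex_inner) \<Rightarrow> 'a set"
  where "null_space f = {x. f x = 0}"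

definition cortho_complement :: "'a::complex_inner set \<Rightarrow> 'a set"
  where "cortho_complement M = {x. \<forall>y\<in>M. cinner x y = 0}"

(* On a Hilbert space the adjoint of a bounded operator exists and is unique, so the choice
   is immaterial there; compare the library's adjoint for real inner product spaces. *)
definition cadjoint :: "('a::complex_inner \<Rightarrow> 'b::complex_inner) \<Rightarrow> 'b \<Rightarrow> 'a"
  where "cadjoint f = (SOME g. \<forall>x y. cinner (f x) y = cinner x (g y))"

definition positive_operator :: "('a::complex_inner \<Rightarrow> 'a) \<Rightarrow> bool"
  where "positive_operator S \<longleftrightarrow>
    bounded_clinear S \<and> S = cadjoint S \<and> (\<forall>x. cinner (S x) x \<in> \<real>\<^sub>\<ge>\<^sub>0)"

definition compact_operator :: "('a::complex_inner \<Rightarrow> 'b::complex_inner) \<Rightarrow> bool"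
  where "compact_operator f \<longleftrightarrow> bounded_clinear f \<and> compact (closure (f ` cball 0 1))"

definition finite_rank_operator :: "('a::complex_inner \<Rightarrow> 'b::complex_inner) \<Rightarrow> bool"
  where "finite_rank_operator f \<longleftrightarrow> bounded_clinear f \<and> cfinite_dim (range f)"

definition partial_isometry :: "('a::complex_inner \<Rightarrow> 'b::complex_inner) \<Rightarrow> bool"
  where "partial_isometry V \<longleftrightarrow>
    bounded_clinear V \<and> (\<forall>x \<in> cortho_complement (null_space V). norm (V x) = norm x)"

(* Operators are total functions, so the restriction of T to a subspace M is expressed by
   relativizing to M: these are m(T|M) and minimum attainment of T|M. *)
definition min_modulus_on :: "'a::complex_inner set \<Rightarrow> ('a \<Rightarrow> 'b::complex_inner) \<Rightarrow> real"
  where "min_modulus_on M T = Inf {norm (T x) | x. x \<in> M \<and> norm x = 1}"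

definition minimum_attaining_on :: "'a::complex_inner set \<Rightarrow> ('a \<Rightarrow> 'b::complex_inner) \<Rightarrow> bool"
  where "minimum_attaining_on M T \<longleftrightarrow>
    (\<exists>x0\<in>M. norm x0 = 1 \<and> norm (T x0) = min_modulus_on M T)"

definition absolutely_minimum_attaining :: "('a::complex_inner \<Rightarrow> 'b::complex_inner) \<Rightarrow> bool"
  where "absolutely_minimum_attaining T \<longleftrightarrow> bounded_clinear T \<and>
    (\<forall>M. csubspace M \<and> closed M \<and> M \<noteq> {0} \<longrightarrow> minimum_attaining_on M T)"

definition AM_decomposition ::
  "('a::complex_inner \<Rightarrow> 'b::complex_inner) \<Rightarrow>
    ('a \<Rightarrow> 'b) \<Rightarrow> real \<Rightarrow> ('a \<Rightarrow> 'a) \<Rightarrow> ('a \<Rightarrow> 'a) \<Rightarrow> bool"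
  where "AM_decomposition T V \<alpha> K F \<longleftrightarrow>
    T = V \<circ> (\<lambda>x. \<alpha> *\<^sub>R x - K x + F x) \<and>
    \<alpha> \<ge> 0 \<and>
    positive_operator K \<and> compact_operator K \<and> onorm K \<le> \<alpha> \<and>
    positive_operator F \<and> finite_rank_operator F \<and>
    K \<circ> F = (\<lambda>x. 0) \<and> F \<circ> K = (\<lambda>x. 0) \<and>
    partial_isometry V \<and>
    null_space V = null_space (\<lambda>x. \<alpha> *\<^sub>R x - K x + F x)"

end

theory Submission
  imports Defs
begin

text \<open>Let \<open>S = T*T\<close>. Minimizers of \<open>\<parallel>T x\<parallel>\<close> on the unit spheres of \<open>S\<close>-invariant subspaces are
  eigenvectors of \<open>S\<close>. If \<open>T\<close> is absolutely minimum attaining, splitting them off successively gives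
  orthonormal eigenvectors with eigenvalues increasing to some \<open>\<beta>\<close>. On their orthocomplement
  \<open>S \<ge> \<beta>\<close>, and only finitely many orthonormal eigenvectors there have eigenvalue \<open>> \<beta>\<close>: otherwise
  interpolating between the two families yields a subspace on which the minimum is not attained. So
  \<open>S\<close> is diagonal up to a multiple of the identity, and \<open>\<alpha> = sqrt \<beta>\<close>, \<open>K\<close> and \<open>F\<close> are functions of
  \<open>S\<close>, while \<open>V\<close> is \<open>T\<close> composed with the pseudo-inverse of \<open>\<alpha> I - K + F\<close>.

  Conversely, let \<open>m\<close> be the infimum of \<open>\<parallel>T x\<parallel>\<close> over the unit sphere of \<open>M\<close>. The parallelogram law
  for the form \<open>\<parallel>T x\<parallel>\<^sup>2 - m\<^sup>2 \<parallel>x\<parallel>\<^sup>2 \<ge> 0\<close> and compactness of \<open>F - K\<close> make a subsequence of a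
  minimizing sequence converge unless \<open>m = \<alpha>\<close>; in that case either \<open>M\<close> meets the kernel of \<open>F\<close>, where
  \<open>\<parallel>T x\<parallel> \<le> \<alpha> \<parallel>x\<parallel>\<close>, or \<open>M\<close> is finite dimensional. Uniqueness rests on positive symmetric
  operators being determined by \<open>\<parallel>P x\<parallel>\<close>, applied to \<open>\<alpha> I - K + F\<close> and to \<open>K + F\<close>.\<close>

text \<open>Cauchy criteria for series such as \<open>summable_Cauchy\<close> live in class
  \<open>banach\<close>.\<close>

instance chilbert_space \<subseteq> banach ..

subsection \<open>Complex inner products\<close>

lemma cinner_add_right: "cinner x (y + z) = cinner x y + cinner x z"
  using cinner_add_left[of y z x] by (metis cinner_commute complex_cnj_add)

lemma cinner_scaleC_right: "cinner x (c *\<^sub>C y) = cnj c * cinner x y"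
  using cinner_scaleC_left[of c y x] by (metis cinner_commute complex_cnj_mult)

lemma cinner_scaleR_left: "cinner (r *\<^sub>R x) y = of_real r * cinner x y"
  by (simp add: scaleR_scaleC cinner_scaleC_left)

lemma cinner_scaleR_right: "cinner x (r *\<^sub>R y) = of_real r * cinner x y"
  by (simp add: scaleR_scaleC cinner_scaleC_right)

lemma cinner_zero_left [simp]: "cinner 0 y = 0"
  using cinner_scaleR_left[of 0 0 y] by simp

lemma cinner_zero_right [simp]: "cinner y 0 = 0"
  using cinner_scaleR_right[of y 0 0] by simp

lemma cinner_minus_left: "cinner (- x) y = - cinner x y"
  using cinner_scaleR_left[of "-1" x y] by simp

lemma cinner_minus_right: "cinner x (- y) = - cinner x y"
  using cinner_scaleR_right[of x "-1" y] by simp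

lemma cinner_diff_left: "cinner (x - y) z = cinner x z - cinner y z"
  using cinner_add_left[of x "- y" z] by (simp add: cinner_minus_left)

lemma cinner_diff_right: "cinner z (x - y) = cinner z x - cinner z y"
  using cinner_add_right[of z x "- y"] by (simp add: cinner_minus_right)

lemmas cinner_simps = cinner_add_left cinner_add_right cinner_diff_left cinner_diff_right
  cinner_minus_left cinner_minus_right cinner_scaleC_left cinner_scaleC_right
  cinner_scaleR_left cinner_scaleR_right

lemma cinner_sum_left: "cinner (\<Sum>i\<in>A. f i) y = (\<Sum>i\<in>A. cinner (f i) y)"
  by (induction A rule: infinite_finite_induct) (simp_all add: cinner_add_left)

lemma cinner_sum_right: "cinner y (\<Sum>i\<in>A. f i) = (\<Sum>i\<in>A. cinner y (f i))"
  by (induction A rule: infinite_finite_induct) (simp_all add: cinner_add_right)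

text \<open>Real inner products with \<open>y\<close> and with \<open>\<i> *\<^sub>C y\<close>
  together recover the complex one. Real facts are lifted to complex ones this way
  throughout.\<close>

lemma Im_cinner: "Im (cinner x y) = inner x (\<i> *\<^sub>C y)"
  by (simp add: inner_eq_Re_cinner cinner_scaleC_right)

lemma cinner_self: "cinner x x = of_real ((norm x)\<^sup>2)"
proof (rule complex_eqI)
  show "Im (cinner x x) = Im (of_real ((norm x)\<^sup>2))"
    by (metis Im_complex_of_real cinner_commute complex_cnj_cnj complex_cnj_complex_of_real
        complex_is_Real_iff Reals_cnj_iff)
qed (simp add: power2_norm_eq_inner inner_eq_Re_cinner flip: of_real_power)

lemma cinner_eq_0_self: "cinner x x = 0 \<longleftrightarrow> x = 0"
  by (simp add: cinner_self)

lemma norm_scaleC: "norm (c *\<^sub>C x) = cmod c * norm (x :: 'a::complex_inner)"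
proof -
  have "complex_of_real ((norm (c *\<^sub>C x))\<^sup>2) = (c * cnj c) * cinner x x"
    by (simp add: cinner_scaleC_left cinner_scaleC_right mult.assoc flip: cinner_self del: of_real_power)
  also have "\<dots> = complex_of_real ((cmod c * norm x)\<^sup>2)"
    by (simp add: cinner_self power_mult_distrib flip: complex_norm_square)
  finally have "(norm (c *\<^sub>C x))\<^sup>2 = (cmod c * norm x)\<^sup>2"
    using of_real_eq_iff by blast
  then show ?thesis by simp
qed

lemma norm_cinner_le: "cmod (cinner x y) \<le> norm x * norm y"
proof (cases "cinner x y = 0")
  case False
  \<comment> \<open>A unimodular phase that turns \<open>cinner x y\<close> into its modulus, so
    that the real Cauchy-Schwarz inequality suffices.\<close>
  define c where "c = cnj (cinner x y) / cmod (cinner x y)"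
  have c: "cmod c = 1" using False by (simp add: c_def norm_divide)
  have "c * cinner x y = cmod (cinner x y)"
    using False by (simp add: c_def field_simps complex_norm_square[symmetric] power2_eq_square)
  then have "cmod (cinner x y) = inner (c *\<^sub>C x) y"
    by (simp add: inner_eq_Re_cinner cinner_scaleC_left)
  also have "\<dots> \<le> norm (c *\<^sub>C x) * norm y" by (rule norm_cauchy_schwarz)
  finally show ?thesis by (simp add: norm_scaleC c)
qed simp

lemma bounded_linear_cinner_left: "bounded_linear (\<lambda>x. cinner x y)"
  by (rule bounded_linear_intro[where K = "norm y"])
    (simp_all add: cinner_add_left cinner_scaleR_left scaleR_conv_of_real norm_cinner_le)

lemma bounded_linear_scaleC_left: "bounded_linear (\<lambda>c. c *\<^sub>C (x :: 'a::complex_inner))"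
  by (rule bounded_linear_intro[where K = "norm x"])
    (simp_all add: scaleC_add_left norm_scaleC scaleR_scaleC scaleC_scaleC scaleC_complex_def)

lemma bounded_clinearD:
  assumes "bounded_clinear f"
  shows bounded_clinear_bounded_linear: "bounded_linear f"
    and bounded_clinear_scaleC: "f (c *\<^sub>C x) = c *\<^sub>C f x"
  using assms by (auto simp: bounded_clinear_def)

lemma csubspaceD:
  assumes "csubspace M"
  shows csubspace_0: "0 \<in> M"
    and csubspace_add: "x \<in> M \<Longrightarrow> y \<in> M \<Longrightarrow> x + y \<in> M"
    and csubspace_scaleC: "x \<in> M \<Longrightarrow> c *\<^sub>C x \<in> M"
    and csubspace_diff: "x \<in> M \<Longrightarrow> y \<in> M \<Longrightarrow> x - y \<in> M"
    and csubspace_scaleR: "x \<in> M \<Longrightarrow> r *\<^sub>R x \<in> M"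
    and csubspace_subspace: "subspace M"
  using assms complex_vector.subspace_def[of M] complex_vector.subspace_diff[of M]
  by (auto simp: scaleR_scaleC subspace_def)

lemma csubspace_cortho_complement: "csubspace (cortho_complement A)"
  by (auto simp: complex_vector.subspace_def cortho_complement_def cinner_simps)

lemma closed_cortho_complement: "closed (cortho_complement A)"
proof -
  have "closed {x. cinner x y = 0}" for y :: 'a
    by (intro closed_Collect_eq continuous_intros
        linear_continuous_on bounded_linear_cinner_left)
  moreover have "cortho_complement A = (\<Inter>y\<in>A. {x. cinner x y = 0})"
    by (auto simp: cortho_complement_def)
  ultimately show ?thesis by auto
qed

subsection \<open>Real Hilbert space: projections, Riesz representation\<close>

text \<open>A sequence of points of \<open>M\<close> whose distances to \<open>x\<close> approach
  the infimum is Cauchy by the parallelogram law. Its limit \<open>p\<close> is a nearest point, and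
  moving \<open>p\<close> inside \<open>M\<close> cannot decrease the distance, which forces
  orthogonality.\<close>

lemma projection_exists:
  fixes x :: "'a::{real_inner,complete_space}"
  assumes M: "subspace M" "closed M"
  obtains p where "p \<in> M" "\<And>y. y \<in> M \<Longrightarrow> inner (x - p) y = 0"
proof -
  define d where "d = Inf ((\<lambda>y. (norm (x - y))\<^sup>2) ` M)"
  have M0: "0 \<in> M" using M subspace_0 by blast
  have bdd: "bdd_below ((\<lambda>y. (norm (x - y))\<^sup>2) ` M)"
    by (rule bdd_belowI[of _ 0]) auto
  have lower: "d \<le> (norm (x - y))\<^sup>2" if "y \<in> M" for y
    unfolding d_def using bdd that by (intro cInf_lower) auto
  have "\<exists>y\<in>M. (norm (x - y))\<^sup>2 < d + 1 / real (Suc n)" for n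
  proof -
    have "Inf ((\<lambda>y. (norm (x - y))\<^sup>2) ` M) < d + 1 / real (Suc n)" by (simp add: d_def)
    then show ?thesis using M0 by (subst (asm) cInf_less_iff) (auto intro: bdd)
  qed
  then obtain y where y: "\<And>n. y n \<in> M" "\<And>n. (norm (x - y n))\<^sup>2 < d + 1 / real (Suc n)"
    by metis
  have close: "(norm (y m - y n))\<^sup>2 \<le> 2 / real (Suc m) + 2 / real (Suc n)" for m n
  proof -
    \<comment> \<open>The midpoint also competes for the infimum \<open>d\<close>, so the
      parallelogram law leaves little room for \<open>y m - y n\<close>.\<close>
    have "(1/2) *\<^sub>R (y m + y n) \<in> M"
      using y M by (meson subspace_add subspace_scale)
    then have "d \<le> (norm (x - (1/2) *\<^sub>R (y m + y n)))\<^sup>2" by (rule lower)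
    moreover have "(norm (y m - y n))\<^sup>2 + 4 * (norm (x - (1/2) *\<^sub>R (y m + y n)))\<^sup>2 =
        2 * (norm (x - y m))\<^sup>2 + 2 * (norm (x - y n))\<^sup>2"
      by (simp add: power2_norm_eq_inner inner_simps inner_commute algebra_simps)
    ultimately show ?thesis using y(2)[of m] y(2)[of n] by simp
  qed
  have "Cauchy y"
  proof (rule metric_CauchyI)
    fix e :: real assume e: "e > 0"
    then obtain N where N: "1 / real (Suc N) < e\<^sup>2 / 4"
      by (meson nat_approx_posE zero_less_divide_iff zero_less_numeral zero_less_power)
    have "dist (y m) (y n) < e" if "m \<ge> N" "n \<ge> N" for m n
    proof -
      have le: "1 / real (Suc k) \<le> 1 / real (Suc N)" if "k \<ge> N" for k
        using that by (simp add: frac_le)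
      have "(norm (y m - y n))\<^sup>2 < e\<^sup>2"
        using close[of m n] N le[OF that(1)] le[OF that(2)] by simp
      then show ?thesis using e by (simp add: dist_norm power_less_imp_less_base)
    qed
    then show "\<exists>N. \<forall>m\<ge>N. \<forall>n\<ge>N. dist (y m) (y n) < e" by blast
  qed
  then obtain p where p: "y \<longlonglongrightarrow> p" using Cauchy_convergent convergent_def by blast
  have pM: "p \<in> M" using closed_sequentially[OF M(2) y(1) p] .
  have "(\<lambda>n. d + 1 / real (Suc n)) \<longlonglongrightarrow> d + 0"
    using LIMSEQ_inverse_real_of_nat by (intro tendsto_intros) (simp add: inverse_eq_divide)
  moreover have "(\<lambda>n. (norm (x - y n))\<^sup>2) \<longlonglongrightarrow> (norm (x - p))\<^sup>2"
    by (intro tendsto_intros p)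
  ultimately have dp: "(norm (x - p))\<^sup>2 \<le> d"
    using y(2) by (intro LIMSEQ_le[of _ _ "\<lambda>n. d + 1 / real (Suc n)"]) (auto intro: less_imp_le)
  have "inner (x - p) z = 0" if z: "z \<in> M" for z
  proof (cases "z = 0")
    case False
    \<comment> \<open>The minimizer of the quadratic
      \<open>t \<mapsto> (norm (x - p - t *\<^sub>R z))\<^sup>2\<close>.\<close>
    define t where "t = inner (x - p) z / (norm z)\<^sup>2"
    have "p + t *\<^sub>R z \<in> M" using pM z M by (meson subspace_add subspace_scale)
    then have "(norm (x - p))\<^sup>2 \<le> (norm (x - (p + t *\<^sub>R z)))\<^sup>2" using lower[of "p + t *\<^sub>R z"] dp by linarith
    also have "\<dots> = (norm (x - p))\<^sup>2 - 2 * t * inner (x - p) z + t\<^sup>2 * (norm z)\<^sup>2"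
      by (simp add: power2_norm_eq_inner inner_simps inner_commute power2_eq_square[of t]
          algebra_simps)
    also have "\<dots> = (norm (x - p))\<^sup>2 - (inner (x - p) z)\<^sup>2 / (norm z)\<^sup>2"
      using False by (simp add: t_def power2_eq_square field_simps)
    finally have "(inner (x - p) z)\<^sup>2 / (norm z)\<^sup>2 \<le> 0" by simp
    then show ?thesis using False by (simp add: divide_le_0_iff)
  qed simp
  with pM that show thesis by blast
qed

text \<open>The representing vector is a multiple of some \<open>w\<close> orthogonal to the kernel
  of \<open>f\<close>: the vector \<open>y - (f y / f w) *\<^sub>R w\<close> lies in that
  kernel.\<close>

lemma riesz_representation_exists:
  fixes f :: "'a::{real_inner,complete_space} \<Rightarrow> real"
  assumes f: "bounded_linear f"
  shows "\<exists>z. \<forall>y. f y = inner z y"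
proof (cases "\<exists>u. f u \<noteq> 0")
  case True
  then obtain u where u: "f u \<noteq> 0" by blast
  interpret f: bounded_linear f by fact
  have "subspace {y. f y = 0}" by (auto simp: subspace_def f.add f.scaleR)
  moreover have "closed {y. f y = 0}"
    by (intro closed_Collect_eq continuous_intros linear_continuous_on f)
  ultimately obtain p where p: "f p = 0" "\<And>y. f y = 0 \<Longrightarrow> inner (u - p) y = 0"
    using projection_exists[of "{y. f y = 0}" u] by auto
  define w where "w = u - p"
  have fw: "f w \<noteq> 0" using u p by (simp add: w_def f.diff)
  then have w0: "w \<noteq> 0" by (metis f.zero)
  have "f y = inner ((f w / inner w w) *\<^sub>R w) y" for y
  proof -
    have "inner w (y - (f y / f w) *\<^sub>R w) = 0"
      unfolding w_def[symmetric] using p(2)[folded w_def] fw by (simp add: f.diff f.scaleR)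
    then show ?thesis using fw w0 by (simp add: inner_simps field_simps)
  qed
  then show ?thesis by blast
qed (auto intro: exI[of _ 0])

lemma csubspace_projection_exists:
  fixes x :: "'a::chilbert_space"
  assumes M: "csubspace M" "closed M"
  obtains p where "p \<in> M" "x - p \<in> cortho_complement M"
proof -
  obtain p where p: "p \<in> M" "\<And>y. y \<in> M \<Longrightarrow> inner (x - p) y = 0"
    using projection_exists[OF csubspace_subspace[OF M(1)] M(2)] by blast
  have "cinner (x - p) y = 0" if "y \<in> M" for y
    using p(2)[OF that] p(2)[OF csubspace_scaleC[OF M(1) that, of \<i>]]
    by (simp add: complex_eq_iff Im_cinner flip: inner_eq_Re_cinner)
  then show thesis using that p by (auto simp: cortho_complement_def)
qed

text \<open>\<open>S\<close> is the operator T*T, obtained directly from Riesz representation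
  without passing through the adjoint of \<open>T\<close>.\<close>

lemma gram_operator_exists:
  fixes T :: "'a::chilbert_space \<Rightarrow> 'b::complex_inner"
  assumes T: "bounded_clinear T"
  shows "\<exists>S. \<forall>x y. cinner (S x) y = cinner (T x) (T y)"
proof -
  note bl = bounded_clinear_bounded_linear[OF T]
  have "\<exists>z. \<forall>y. inner (T x) (T y) = inner z y" for x
    by (intro riesz_representation_exists bounded_linear_inner_right_comp bl)
  then obtain S where S: "\<And>x y. inner (T x) (T y) = inner (S x) y" by metis
  have "cinner (S x) y = cinner (T x) (T y)" for x y
    using S[of x y] S[of x "\<i> *\<^sub>C y"] bounded_clinear_scaleC[OF T, of \<i> y]
    by (simp add: complex_eq_iff Im_cinner flip: inner_eq_Re_cinner)
  then show ?thesis by blast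
qed

subsection \<open>Orthonormal systems\<close>

text \<open>The family is indexed so that one notion covers both sequences (\<open>I = UNIV\<close>)
  and sets of vectors (\<open>g\<close> the identity).\<close>

definition corthonormal :: "'i set \<Rightarrow> ('i \<Rightarrow> 'a::complex_inner) \<Rightarrow> bool"
  where "corthonormal I g \<longleftrightarrow> (\<forall>i\<in>I. \<forall>j\<in>I. cinner (g i) (g j) = of_bool (i = j))"

lemma corthonormalD:
  "corthonormal I g \<Longrightarrow> i \<in> I \<Longrightarrow> j \<in> I \<Longrightarrow> cinner (g i) (g j) = of_bool (i = j)"
  by (simp add: corthonormal_def)

lemma corthonormal_norm: "corthonormal I g \<Longrightarrow> i \<in> I \<Longrightarrow> norm (g i) = 1"
  using corthonormalD[of I g i i] inner_eq_Re_cinner[of "g i" "g i"]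
  by (simp add: norm_eq_sqrt_inner)

lemma corthonormal_subset: "corthonormal I g \<Longrightarrow> J \<subseteq> I \<Longrightarrow> corthonormal J g"
  unfolding corthonormal_def by blast

lemma corthonormal_insert:
  assumes "corthonormal A (\<lambda>x. x)" "norm b = 1" "b \<in> cortho_complement A"
  shows "corthonormal (insert b A) (\<lambda>x. x)"
proof -
  have "cinner b a = 0" "cinner a b = 0" if "a \<in> A" for a
    using assms(3) that cinner_commute[of a b] by (auto simp: cortho_complement_def)
  moreover have "b \<notin> A"
    using assms(2) calculation(1)[of b] by (auto simp: cinner_self)
  ultimately show ?thesis
    using assms by (auto simp: corthonormal_def cinner_self)
qed

lemma cinner_corthonormal_sum:
  assumes "corthonormal I g" "finite J" "J \<subseteq> I" "i \<in> I"
  shows "cinner (\<Sum>j\<in>J. a j *\<^sub>C g j) (g i) = (if i \<in> J then a i else 0)"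
proof -
  have "cinner (\<Sum>j\<in>J. a j *\<^sub>C g j) (g i) = (\<Sum>j\<in>J. if j = i then a j else 0)"
    unfolding cinner_sum_left
    by (intro sum.cong) (use assms in \<open>auto simp: cinner_scaleC_left corthonormalD subsetD\<close>)
  then show ?thesis using assms by simp
qed

lemma norm_corthonormal_sum:
  assumes "corthonormal J g" "finite J"
  shows "(norm (\<Sum>j\<in>J. a j *\<^sub>C g j))\<^sup>2 = (\<Sum>j\<in>J. (cmod (a j))\<^sup>2)"
proof -
  have "complex_of_real ((norm (\<Sum>j\<in>J. a j *\<^sub>C g j))\<^sup>2) = (\<Sum>j\<in>J. cnj (a j) * a j)"
    unfolding cinner_self[symmetric]
    by (subst cinner_sum_right, intro sum.cong refl)
      (use assms in \<open>simp add: cinner_scaleC_right cinner_corthonormal_sum[OF assms(1)]\<close>)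
  also have "\<dots> = complex_of_real (\<Sum>j\<in>J. (cmod (a j))\<^sup>2)"
    by (simp add: complex_norm_square mult.commute del: of_real_power)
  finally show ?thesis using of_real_eq_iff by blast
qed

lemma cinner_corthonormal_remainder:
  assumes "corthonormal J g" "finite J" "i \<in> J"
  shows "cinner (x - (\<Sum>j\<in>J. cinner x (g j) *\<^sub>C g j)) (g i) = 0"
  using cinner_corthonormal_sum[OF assms(1,2) subset_refl assms(3)] assms(3)
  by (simp add: cinner_diff_left)

lemma bessel_inequality:
  assumes "corthonormal J g" "finite J"
  shows "(\<Sum>j\<in>J. (cmod (cinner x (g j)))\<^sup>2) \<le> (norm x)\<^sup>2"
proof -
  define p where "p = (\<Sum>j\<in>J. cinner x (g j) *\<^sub>C g j)"
  have "cinner (x - p) p = 0"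
    unfolding p_def cinner_sum_right
    by (intro sum.neutral) (simp add: cinner_scaleC_right cinner_corthonormal_remainder assms)
  then have "inner (x - p) p = 0" by (simp add: inner_eq_Re_cinner)
  then have "(norm x)\<^sup>2 = (norm (x - p))\<^sup>2 + (norm p)\<^sup>2"
    by (simp add: power2_norm_eq_inner inner_simps inner_commute)
  then have "(norm p)\<^sup>2 \<le> (norm x)\<^sup>2" by simp
  then show ?thesis by (simp add: p_def norm_corthonormal_sum assms)
qed

text \<open>Gram-Schmidt, one generator at a time; a generator without a component orthogonal to
  \<open>A\<close> leaves \<open>A\<close> unchanged.\<close>

lemma finite_corthonormal_basis_exists:
  assumes "finite (B :: 'a::complex_inner set)"
  shows "\<exists>A. finite A \<and> corthonormal A (\<lambda>x. x) \<and>
    (\<forall>x\<in>cspan B. x = (\<Sum>a\<in>A. cinner x a *\<^sub>C a))"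
  using assms
proof (induction B)
  case empty
  show ?case by (intro exI[of _ "{}"]) (auto simp: corthonormal_def complex_vector.span_empty)
next
  case (insert b B)
  then obtain A where A: "finite A" "corthonormal A (\<lambda>x. x)"
    and B: "\<And>x. x \<in> cspan B \<Longrightarrow> x = (\<Sum>a\<in>A. cinner x a *\<^sub>C a)" by blast
  \<comment> \<open>\<open>q C\<close> is the orthogonal projection onto the span of an orthonormal
    \<open>C\<close>. Its fixed points form a subspace, so the expansion need only be checked on
    generators.\<close>
  define q where "q C x = (\<Sum>a\<in>C. cinner x a *\<^sub>C a)" for C and x :: 'a
  have "q C (x + y) = q C x + q C y" "q C (c *\<^sub>C x) = c *\<^sub>C q C x" "q C 0 = 0" for C x y c
    by (simp_all add: q_def cinner_simps scaleC_add_left sum.distrib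
        complex_vector.scale_sum_right scaleC_scaleC complex_vector.scale_zero_left)
  then have sub: "csubspace {x. x = q C x}" for C
    unfolding complex_vector.subspace_def by simp
  define b' where "b' = b - q A b"
  have b': "cinner b' a = 0" if "a \<in> A" for a
    using cinner_corthonormal_remainder[OF A(2,1) that] by (simp add: b'_def q_def)
  have *: "?case" if C: "finite C" "corthonormal C (\<lambda>x. x)" "b = q C b" "\<And>x. x \<in> B \<Longrightarrow> x = q C x" for C
  proof -
    have "cspan (insert b B) \<subseteq> {x. x = q C x}"
      using C by (intro complex_vector.span_minimal sub) auto
    then show ?thesis using C unfolding q_def by blast
  qed
  have Bq: "x = q A x" if "x \<in> B" for x
    using B[OF complex_vector.span_base[OF that]] by (simp add: q_def)
  show ?case
  proof (cases "b' = 0")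
    case True
    then show ?thesis by (intro *[of A]) (use A Bq b'_def in auto)
  next
    case False
    define c where "c = (1 / norm b') *\<^sub>R b'"
    have c: "c \<in> cortho_complement A" "norm c = 1"
      using False b' by (auto simp: c_def cortho_complement_def cinner_simps)
    have cA: "c \<notin> A" using c by (auto simp: cortho_complement_def cinner_eq_0_self)
    have qc: "q (insert c A) x = cinner x c *\<^sub>C c + q A x" for x
      using A cA by (simp add: q_def)
    have ac: "cinner a c = 0" if "a \<in> A" for a
      using c(1) that cinner_commute[of a c] by (auto simp: cortho_complement_def)
    have qac: "cinner (q A x) c = 0" for x
      unfolding q_def cinner_sum_left by (simp add: cinner_simps ac)
    have "cinner b c = cinner b' c"
      by (simp add: b'_def cinner_simps qac)
    also have "\<dots> = of_real (norm b')"
      by (simp add: c_def cinner_simps cinner_self power2_eq_square)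
    finally have "cinner b c *\<^sub>C c = b'"
      using False by (simp add: c_def scaleR_scaleC scaleC_scaleC scaleC_one)
    then have "b = q (insert c A) b" by (simp add: qc b'_def)
    moreover have "x = q (insert c A) x" if "x \<in> B" for x
    proof -
      have "cinner x c = 0" using qac[of x] Bq[OF that] by simp
      then show ?thesis using Bq[OF that] by (simp add: qc complex_vector.scale_zero_left)
    qed
    ultimately show ?thesis
      by (intro *[of "insert c A"]) (use A c corthonormal_insert in auto)
  qed
qed

section \<open>Orthonormal sequences by successive choice\<close>

lemma unit_vector_cortho_complement:
  assumes "\<not> cfinite_dim (UNIV :: 'a::complex_inner set)"
    and A: "finite A" "corthonormal A (\<lambda>x. x)"
  shows "\<exists>x\<in>cortho_complement A. norm (x :: 'a) = 1"
proof -
  have "\<exists>x. x - (\<Sum>a\<in>A. cinner x a *\<^sub>C a) \<noteq> 0"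
  proof (rule ccontr)
    assume "\<not> ?thesis"
    then have eq: "x = (\<Sum>a\<in>A. cinner x a *\<^sub>C a)" for x by simp
    have "x \<in> cspan A" for x
      by (subst eq) (intro complex_vector.span_sum complex_vector.span_scale
          complex_vector.span_base)
    then have "cspan A = UNIV" by auto
    with assms A show False unfolding cfinite_dim_def by blast
  qed
  then obtain x where x: "x - (\<Sum>a\<in>A. cinner x a *\<^sub>C a) \<noteq> 0" by blast
  define y where "y = x - (\<Sum>a\<in>A. cinner x a *\<^sub>C a)"
  have "y \<in> cortho_complement A"
    using cinner_corthonormal_remainder[OF A(2,1)] by (auto simp: y_def cortho_complement_def)
  then have "(1 / norm y) *\<^sub>R y \<in> cortho_complement A"
    by (rule csubspace_scaleR[OF csubspace_cortho_complement])
  then show ?thesis using x y_def by (intro bexI[of _ "(1 / norm y) *\<^sub>R y"]) auto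
qed

text \<open>Dependent choice in which the next term may depend on the set of all earlier terms;
  \<open>P\<close> is the invariant of that set and \<open>Q\<close> the property of the new
  term.\<close>

lemma greedy_sequence:
  assumes step: "\<And>A. finite A \<Longrightarrow> P A \<Longrightarrow> \<exists>x. Q A x \<and> P (insert x A)" and "P {}"
  shows "\<exists>f. \<forall>n::nat. P (f ` {..<n}) \<and> Q (f ` {..<n}) (f n)"
proof -
  \<comment> \<open>Guarding by the invariant makes a choice possible at every stage; that the guard
    always holds is shown afterwards by induction.\<close>
  have "\<exists>f. \<forall>n::nat. (finite (f ` {..<n}) \<and> P (f ` {..<n}) \<longrightarrow>
      Q (f ` {..<n}) (f n) \<and> P (insert (f n) (f ` {..<n})))"
  proof (rule dependent_wellorder_choice[where P = "\<lambda>f n x. finite (f ` {..<n}) \<and> P (f ` {..<n}) \<longrightarrow>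
      Q (f ` {..<n}) x \<and> P (insert x (f ` {..<n}))"])
    show "(finite (f ` {..<n}) \<and> P (f ` {..<n}) \<longrightarrow> Q (f ` {..<n}) r \<and> P (insert r (f ` {..<n}))) =
      (finite (g ` {..<n}) \<and> P (g ` {..<n}) \<longrightarrow> Q (g ` {..<n}) r \<and> P (insert r (g ` {..<n})))"
      if "\<And>y. y < n \<Longrightarrow> f y = g y" for r and f g :: "nat \<Rightarrow> 'a" and n
    proof -
      have "f ` {..<n} = g ` {..<n}" using that by auto
      then show ?thesis by simp
    qed
  qed (use step in blast)
  then obtain f where f: "\<And>n::nat. P (f ` {..<n}) \<Longrightarrow>
      Q (f ` {..<n}) (f n) \<and> P (insert (f n) (f ` {..<n}))" by auto
  have "P (f ` {..<n})" for n
  proof (induction n)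
    case (Suc n)
    then show ?case using f[of n] by (simp add: lessThan_Suc)
  qed (simp add: \<open>P {}\<close>)
  with f show ?thesis by blast
qed

lemma corthonormal_nat:
  assumes "\<And>n. norm (f n) = 1" "\<And>n. f n \<in> cortho_complement (f ` {..<n})"
  shows "corthonormal (UNIV :: nat set) f"
proof -
  have lt: "cinner (f n) (f m) = 0" if "m < n" for m n
    using assms(2)[of n] that by (auto simp: cortho_complement_def)
  have "cinner (f m) (f n) = of_bool (m = n)" for m n
    using lt[of m n] lt[of n m] cinner_commute[of "f m" "f n"] assms(1)[of n]
    by (cases m n rule: linorder_cases) (auto simp: cinner_self)
  then show ?thesis by (simp add: corthonormal_def)
qed

lemma corthonormal_sequence_exists:
  assumes "\<not> cfinite_dim (UNIV :: 'a::complex_inner set)"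
  shows "\<exists>f :: nat \<Rightarrow> 'a. corthonormal UNIV f"
proof -
  have "\<exists>f :: nat \<Rightarrow> 'a. \<forall>n. corthonormal (f ` {..<n}) (\<lambda>x. x) \<and>
      (norm (f n) = 1 \<and> f n \<in> cortho_complement (f ` {..<n}))"
  proof (rule greedy_sequence[where P = "\<lambda>A. corthonormal A (\<lambda>x. x)"
        and Q = "\<lambda>A x. norm x = 1 \<and> x \<in> cortho_complement A"])
    show "\<exists>x. (norm x = 1 \<and> x \<in> cortho_complement A) \<and> corthonormal (insert x A) (\<lambda>x. x)"
      if "finite A" "corthonormal A (\<lambda>x. x)" for A :: "'a set"
      using unit_vector_cortho_complement[OF assms that] corthonormal_insert[OF that(2)] by blast
  qed (simp add: corthonormal_def)
  then show ?thesis using corthonormal_nat by blast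
qed

lemma csubspace_range:
  assumes f: "bounded_clinear f"
  shows "csubspace (range f)"
  unfolding complex_vector.subspace_def
proof (intro conjI ballI allI)
  note lin = linear_simps[OF bounded_clinear_bounded_linear[OF f]]
  show "0 \<in> range f" using lin(3) by (metis rangeI)
  show "x + y \<in> range f" if xy: "x \<in> range f" "y \<in> range f" for x y
  proof -
    obtain a b where "x = f a" "y = f b" using xy by auto
    then have "x + y = f (a + b)" by (simp add: lin(1))
    then show ?thesis by simp
  qed
  show "c *\<^sub>C x \<in> range f" if x: "x \<in> range f" for c x
  proof -
    obtain a where "x = f a" using x by auto
    then have "c *\<^sub>C x = f (c *\<^sub>C a)" by (simp add: bounded_clinear_scaleC[OF f])
    then show ?thesis by simp
  qed
qed

subsection \<open>Diagonal operators\<close>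

text \<open>The operator with eigenvalues \<open>c n\<close> on \<open>g n\<close> and \<open>\<gamma>\<close> on the orthocomplement of the \<open>g n\<close>.\<close>

definition diag_op :: "(nat \<Rightarrow> 'a::chilbert_space) \<Rightarrow> (nat \<Rightarrow> real) \<Rightarrow> real \<Rightarrow> 'a \<Rightarrow> 'a"
  where "diag_op g c \<gamma> x = \<gamma> *\<^sub>R x + (\<Sum>n. (of_real (c n - \<gamma>) * cinner x (g n)) *\<^sub>C g n)"

lemma diag_op_zero: "diag_op g (\<lambda>n. 0) 0 x = 0"
  by (simp add: diag_op_def complex_vector.scale_zero_left)

lemma diag_op_diff_const: "diag_op g c \<gamma> x = \<gamma> *\<^sub>R x + diag_op g (\<lambda>n. c n - \<gamma>) 0 x"
  by (simp add: diag_op_def)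

lemma Bseq_diff_const: "Bseq c \<Longrightarrow> Bseq (\<lambda>n. c n - (\<gamma>::real))"
  using Bseq_add[of c "- \<gamma>"] by simp

context
  fixes g :: "nat \<Rightarrow> 'a::chilbert_space"
  assumes g: "corthonormal UNIV g"
begin

lemma summable_bessel: "summable (\<lambda>n. (cmod (cinner x (g n)))\<^sup>2)"
  by (rule summableI_nonneg_bounded[where x = "(norm x)\<^sup>2"])
    (auto intro: bessel_inequality corthonormal_subset[OF g])

lemma summable_corthonormal:
  assumes "summable (\<lambda>n. (cmod (a n))\<^sup>2)"
  shows "summable (\<lambda>n. a n *\<^sub>C g n)"
  unfolding summable_Cauchy
proof (intro allI impI)
  fix e :: real assume e: "e > 0"
  then obtain N where N: "\<And>m n. m \<ge> N \<Longrightarrow> norm (\<Sum>k=m..<n. (cmod (a k))\<^sup>2) < e\<^sup>2"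
    using assms unfolding summable_Cauchy by (meson zero_less_power)
  have "norm (\<Sum>k=m..<n. a k *\<^sub>C g k) < e" if "m \<ge> N" for m n
  proof -
    have "(norm (\<Sum>k=m..<n. a k *\<^sub>C g k))\<^sup>2 < e\<^sup>2"
      using N[OF that, of n] corthonormal_subset[OF g, of "{m..<n}"]
      by (simp add: norm_corthonormal_sum)
    then show ?thesis using e by (simp add: power_less_imp_less_base)
  qed
  then show "\<exists>N. \<forall>m\<ge>N. \<forall>n. norm (\<Sum>k=m..<n. a k *\<^sub>C g k) < e" by blast
qed

lemma summable_diag:
  assumes "Bseq c"
  shows "summable (\<lambda>n. (of_real (c n) * cinner x (g n)) *\<^sub>C g n)"
proof (rule summable_corthonormal)
  obtain C where C: "\<And>n. \<bar>c n\<bar> \<le> C" using BseqD[OF assms] by auto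
  show "summable (\<lambda>n. (cmod (of_real (c n) * cinner x (g n)))\<^sup>2)"
  proof (rule summable_comparison_test')
    show "summable (\<lambda>n. C\<^sup>2 * (cmod (cinner x (g n)))\<^sup>2)"
      by (intro summable_mult summable_bessel)
    fix n
    have "\<bar>c n\<bar>\<^sup>2 \<le> C\<^sup>2" using C[of n] by (intro power_mono) auto
    then show "norm ((cmod (of_real (c n) * cinner x (g n)))\<^sup>2) \<le> C\<^sup>2 * (cmod (cinner x (g n)))\<^sup>2"
      by (simp add: norm_mult power_mult_distrib mult_right_mono)
  qed
qed

lemma cinner_diag_op:
  assumes "Bseq c"
  shows "cinner (diag_op g c \<gamma> x) v =
    of_real \<gamma> * cinner x v + (\<Sum>n. (of_real (c n - \<gamma>) * cinner x (g n)) * cinner (g n) v)"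
  unfolding diag_op_def cinner_add_left cinner_scaleR_left
  using bounded_linear.suminf[OF bounded_linear_cinner_left summable_diag[OF Bseq_diff_const[OF assms]],
      of \<gamma> x v]
  by (simp add: cinner_scaleC_left)

lemma cinner_diag_op_basis:
  assumes "Bseq c"
  shows "cinner (diag_op g c \<gamma> x) (g n) = of_real (c n) * cinner x (g n)"
proof -
  have "(\<Sum>k. (of_real (c k - \<gamma>) * cinner x (g k)) * cinner (g k) (g n)) =
      (\<Sum>k\<in>{n}. (of_real (c k - \<gamma>) * cinner x (g k)) * cinner (g k) (g n))"
    by (rule suminf_finite) (auto simp: corthonormalD[OF g])
  then show ?thesis
    using assms by (simp add: cinner_diag_op corthonormalD[OF g] algebra_simps)
qed

lemma cinner_diag_op_cortho:
  assumes "Bseq c" "v \<in> cortho_complement (range g)"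
  shows "cinner (diag_op g c \<gamma> x) v = of_real \<gamma> * cinner x v"
proof -
  have "cinner (g n) v = 0" for n
    using assms(2) cinner_commute[of "g n" v] by (auto simp: cortho_complement_def)
  then show ?thesis using assms by (simp add: cinner_diag_op)
qed

text \<open>The vectors \<open>g n\<close> and their orthocomplement separate points. Identities
  between diagonal operators thereby reduce to scalar identities between eigenvalues.\<close>

lemma diag_ext:
  assumes "\<And>n. cinner y (g n) = cinner z (g n)"
    and "\<And>v. v \<in> cortho_complement (range g) \<Longrightarrow> cinner y v = cinner z v"
  shows "y = z"
proof -
  have "y - z \<in> cortho_complement (range g)"
    using assms(1) by (auto simp: cortho_complement_def cinner_simps)
  then have "cinner (y - z) (y - z) = 0"
    using assms(2) by (simp add: cinner_diff_left)
  then show ?thesis by (simp add: cinner_eq_0_self)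
qed

lemma diag_op_compose:
  assumes "Bseq c" "Bseq d"
  shows "diag_op g c \<gamma> (diag_op g d \<delta> x) = diag_op g (\<lambda>n. c n * d n) (\<gamma> * \<delta>) x"
  by (rule diag_ext) (simp_all add: cinner_diag_op_basis cinner_diag_op_cortho assms Bseq_mult)

lemma norm_diag_op_0_le:
  assumes "\<And>n. \<bar>c n\<bar> \<le> C"
  shows "norm (diag_op g c 0 x) \<le> C * norm x"
proof -
  have C: "C \<ge> 0" using assms[of 0] by simp
  have "Bseq c" using assms by (intro BseqI'[of _ C]) simp
  then have "(\<lambda>N. \<Sum>n<N. (of_real (c n) * cinner x (g n)) *\<^sub>C g n) \<longlonglongrightarrow> diag_op g c 0 x"
    using summable_LIMSEQ[OF summable_diag[of c x]] by (simp add: diag_op_def)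
  then have "(\<lambda>N. norm (\<Sum>n<N. (of_real (c n) * cinner x (g n)) *\<^sub>C g n)) \<longlonglongrightarrow> norm (diag_op g c 0 x)"
    by (rule tendsto_norm)
  moreover have "norm (\<Sum>n<N. (of_real (c n) * cinner x (g n)) *\<^sub>C g n) \<le> C * norm x" for N
  proof (rule power2_le_imp_le)
    have "(norm (\<Sum>n<N. (of_real (c n) * cinner x (g n)) *\<^sub>C g n))\<^sup>2 =
        (\<Sum>n<N. (c n)\<^sup>2 * (cmod (cinner x (g n)))\<^sup>2)"
      using corthonormal_subset[OF g, of "{..<N}"]
      by (simp add: norm_corthonormal_sum norm_mult power_mult_distrib)
    also have "\<dots> \<le> (\<Sum>n<N. C\<^sup>2 * (cmod (cinner x (g n)))\<^sup>2)"
      using assms C by (intro sum_mono mult_right_mono) (simp_all add: abs_le_square_iff[symmetric])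
    also have "\<dots> \<le> C\<^sup>2 * (norm x)\<^sup>2"
      using bessel_inequality[OF corthonormal_subset[OF g], of "{..<N}"]
      by (simp add: sum_distrib_left[symmetric] mult_left_mono)
    finally show "(norm (\<Sum>n<N. (of_real (c n) * cinner x (g n)) *\<^sub>C g n))\<^sup>2 \<le> (C * norm x)\<^sup>2"
      by (simp add: power_mult_distrib)
  qed (simp add: C)
  ultimately show ?thesis using LIMSEQ_le_const2 by blast
qed

lemma bounded_clinear_diag_op:
  assumes "Bseq c"
  shows "bounded_clinear (diag_op g c \<gamma>)"
proof -
  have add: "diag_op g c \<gamma> (x + y) = diag_op g c \<gamma> x + diag_op g c \<gamma> y" for x y
    by (rule diag_ext) (simp_all add: cinner_diag_op_basis cinner_diag_op_cortho assms cinner_simps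
        algebra_simps)
  have scale: "diag_op g c \<gamma> (a *\<^sub>C x) = a *\<^sub>C diag_op g c \<gamma> x" for a x
    by (rule diag_ext) (simp_all add: cinner_diag_op_basis cinner_diag_op_cortho assms cinner_simps
        algebra_simps)
  obtain C where C: "\<And>n. \<bar>c n - \<gamma>\<bar> \<le> C" using BseqD[OF Bseq_diff_const[OF assms]] by auto
  have "norm (diag_op g c \<gamma> x) \<le> norm x * (\<bar>\<gamma>\<bar> + C)" for x
    using norm_diag_op_0_le[of "\<lambda>n. c n - \<gamma>" C x, OF C] norm_triangle_ineq[of "\<gamma> *\<^sub>R x"]
    by (subst diag_op_diff_const) (smt (verit) norm_scaleR distrib_left mult.commute)
  then show ?thesis
    unfolding bounded_clinear_def
    by (auto intro!: bounded_linear_intro[where K = "\<bar>\<gamma>\<bar> + C"] simp: add scale scaleR_scaleC)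
qed

lemma cinner_diag_op_commute:
  assumes "Bseq c"
  shows "cinner (diag_op g c \<gamma> x) y = cinner x (diag_op g c \<gamma> y)"
proof -
  have "cinner x (diag_op g c \<gamma> y) = cnj (cinner (diag_op g c \<gamma> y) x)"
    by (rule cinner_commute)
  also have "\<dots> = of_real \<gamma> * cinner x y +
      (\<Sum>n. cnj (of_real (c n - \<gamma>) * cinner y (g n) * cinner (g n) x))"
  proof -
    have "summable (\<lambda>n. of_real (c n - \<gamma>) * cinner y (g n) * cinner (g n) x)"
      using bounded_linear.summable[OF bounded_linear_cinner_left
          summable_diag[OF Bseq_diff_const[OF assms]], of \<gamma> y x]
      by (simp add: cinner_scaleC_left)
    then show ?thesis
      using assms cinner_commute[of x y] bounded_linear.suminf[OF bounded_linear_cnj]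
      by (simp add: cinner_diag_op)
  qed
  also have "(\<Sum>n. cnj (of_real (c n - \<gamma>) * cinner y (g n) * cinner (g n) x)) =
      (\<Sum>n. of_real (c n - \<gamma>) * cinner x (g n) * cinner (g n) y)"
  proof -
    have "cnj (of_real (c n - \<gamma>) * cinner y (g n) * cinner (g n) x) =
        of_real (c n - \<gamma>) * cinner x (g n) * cinner (g n) y" for n
      using cinner_commute[of "g n" y] cinner_commute[of x "g n"] by simp
    then show ?thesis by (rule suminf_cong)
  qed
  finally show ?thesis using assms by (simp add: cinner_diag_op)
qed

lemma cinner_diag_op_0_nonneg:
  assumes "Bseq c" "\<And>n. c n \<ge> 0"
  shows "cinner (diag_op g c 0 x) x \<in> \<real>\<^sub>\<ge>\<^sub>0"
proof -
  have *: "of_real (c n) * cinner x (g n) * cinner (g n) x =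
      of_real (c n * (cmod (cinner x (g n)))\<^sup>2)" for n
    using cinner_commute[of "g n" x] complex_norm_square[of "cinner x (g n)"]
    by (simp add: mult.assoc)
  have "summable (\<lambda>n. of_real (c n) * cinner x (g n) * cinner (g n) x)"
    using bounded_linear.summable[OF bounded_linear_cinner_left summable_diag[OF assms(1)], of x x]
    by (simp add: cinner_scaleC_left)
  then have "summable (\<lambda>n. c n * (cmod (cinner x (g n)))\<^sup>2)"
    unfolding * summable_of_real_iff .
  moreover have "cinner (diag_op g c 0 x) x = (\<Sum>n. of_real (c n * (cmod (cinner x (g n)))\<^sup>2))"
    using assms(1) by (simp add: cinner_diag_op *)
  ultimately have "cinner (diag_op g c 0 x) x = of_real (\<Sum>n. c n * (cmod (cinner x (g n)))\<^sup>2)"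
    and "(\<Sum>n. c n * (cmod (cinner x (g n)))\<^sup>2) \<ge> 0"
    using assms(2) by (simp_all add: suminf_of_real suminf_nonneg del: of_real_mult)
  then show ?thesis by (simp add: nonneg_Reals_of_real_iff)
qed

end

subsection \<open>Compactness\<close>

text \<open>The set is a Minkowski sum of continuous images of a closed disk, one for each vector,
  and such sums stay compact.\<close>

lemma compact_finite_combinations:
  fixes h :: "'i \<Rightarrow> 'a::complex_inner"
  assumes "finite A"
  shows "\<exists>S. compact S \<and> (\<forall>f. (\<forall>a\<in>A. cmod (f a) \<le> r) \<longrightarrow> (\<Sum>a\<in>A. f a *\<^sub>C h a) \<in> S)"
  using assms
proof (induction A)
  case empty
  show ?case by (intro exI[of _ "{0}"]) auto
next
  case (insert b A)
  then obtain S where S: "compact S" "\<And>f. (\<forall>a\<in>A. cmod (f a) \<le> r) \<Longrightarrow> (\<Sum>a\<in>A. f a *\<^sub>C h a) \<in> S"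
    by blast
  have "compact ((\<lambda>c. c *\<^sub>C h b) ` cball 0 r)"
    by (intro compact_continuous_image linear_continuous_on bounded_linear_scaleC_left) simp
  then have "compact {x + y |x y. x \<in> (\<lambda>c. c *\<^sub>C h b) ` cball 0 r \<and> y \<in> S}"
    using S(1) by (rule compact_sums)
  moreover have "(\<Sum>a\<in>insert b A. f a *\<^sub>C h a) \<in>
      {x + y |x y. x \<in> (\<lambda>c. c *\<^sub>C h b) ` cball 0 r \<and> y \<in> S}"
    if "\<forall>a\<in>insert b A. cmod (f a) \<le> r" for f
  proof -
    have "(\<Sum>a\<in>A. f a *\<^sub>C h a) \<in> S" "f b *\<^sub>C h b \<in> (\<lambda>c. c *\<^sub>C h b) ` cball 0 r"
      using S(2)[of f] that by auto
    then show ?thesis using insert.hyps by auto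
  qed
  ultimately show ?case by blast
qed

lemma compact_closure_approx:
  fixes X :: "'a::{metric_space,complete_space} set"
  assumes "\<And>e. e > 0 \<Longrightarrow> \<exists>S. compact S \<and> (\<forall>x\<in>X. \<exists>y\<in>S. dist x y < e)"
  shows "compact (closure X)"
  unfolding compact_eq_totally_bounded
proof (intro conjI allI impI)
  show "complete (closure X)" by (simp add: complete_eq_closed)
  fix e :: real assume e: "e > 0"
  \<comment> \<open>One third of \<open>e\<close> each for passing to the closure, for approximation
    by \<open>S\<close>, and for the finite net of \<open>S\<close>.\<close>
  then obtain S where S: "compact S" "\<And>x. x \<in> X \<Longrightarrow> \<exists>y\<in>S. dist x y < e / 3"
    using assms[of "e / 3"] by auto
  then obtain k where k: "finite k" "S \<subseteq> (\<Union>x\<in>k. ball x (e / 3))"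
    using e unfolding compact_eq_totally_bounded by (meson zero_less_divide_iff zero_less_numeral)
  have "closure X \<subseteq> (\<Union>x\<in>k. ball x e)"
  proof
    fix x assume "x \<in> closure X"
    then obtain x' where x': "x' \<in> X" "dist x' x < e / 3"
      using e closure_approachable[of x X] by (meson zero_less_divide_iff zero_less_numeral)
    obtain y where y: "y \<in> S" "dist x' y < e / 3" using S(2) x' by blast
    then obtain z where z: "z \<in> k" "dist z y < e / 3" using k by auto
    have "dist z x < e"
      using x' y z dist_triangle[of z x y] dist_triangle[of y x x'] by (simp add: dist_commute)
    then show "x \<in> (\<Union>x\<in>k. ball x e)" using z by auto
  qed
  then show "\<exists>k. finite k \<and> closure X \<subseteq> (\<Union>x\<in>k. ball x e)" using k by blast
qed

text \<open>Cutting off the series at \<open>N\<close> sends the unit ball into a compact set, and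
  the tail has operator norm at most \<open>e / 2\<close> because the eigenvalues tend to 0.\<close>

lemma compact_operator_diag_op_0:
  assumes g: "corthonormal UNIV g" and c: "c \<longlonglongrightarrow> 0"
  shows "compact_operator (diag_op g c 0)"
proof -
  have B: "Bseq c" using c by (intro convergent_imp_Bseq) (auto simp: convergent_def)
  have "compact (closure (diag_op g c 0 ` cball 0 1))"
  proof (rule compact_closure_approx)
    fix e :: real assume e: "e > 0"
    then obtain N where N: "\<And>n. n \<ge> N \<Longrightarrow> \<bar>c n\<bar> < e / 2"
      using LIMSEQ_D[OF c, of "e / 2"] by auto
    obtain C where C: "\<And>n. \<bar>c n\<bar> \<le> C" using BseqD[OF B] by auto
    obtain S where S: "compact S"
      "\<And>f. (\<forall>n\<in>{..<N}. cmod (f n) \<le> C) \<Longrightarrow> (\<Sum>n<N. f n *\<^sub>C g n) \<in> S"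
      using compact_finite_combinations[of "{..<N}" C g] by auto
    have "\<exists>y\<in>S. dist (diag_op g c 0 x) y < e" if "norm x \<le> 1" for x
    proof
      define y where "y = (\<Sum>n<N. (of_real (c n) * cinner x (g n)) *\<^sub>C g n)"
      \<comment> \<open>The tail is itself a diagonal operator, so \<open>norm_diag_op_0_le\<close>
        bounds it.\<close>
      define c' where "c' n = (if n < N then 0 else c n)" for n
      have le: "cmod (of_real (c n) * cinner x (g n)) \<le> C" for n
      proof -
        have "cmod (cinner x (g n)) \<le> 1"
          using norm_cinner_le[of x "g n"] that corthonormal_norm[OF g, of n] by simp
        then have "\<bar>c n\<bar> * cmod (cinner x (g n)) \<le> \<bar>c n\<bar> * 1"
          by (intro mult_left_mono) auto
        with C[of n] show ?thesis by (simp add: norm_mult)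
      qed
      show "y \<in> S" unfolding y_def by (rule S(2)) (simp add: le)
      have B': "Bseq c'"
        using C by (intro BseqI'[of _ C]) (auto simp: c'_def intro: order_trans[OF abs_ge_zero])
      have "diag_op g c 0 x - y = diag_op g c' 0 x"
      proof -
        have "diag_op g c 0 x = (\<Sum>n. (of_real (c (n + N)) * cinner x (g (n + N))) *\<^sub>C g (n + N)) + y"
          using suminf_split_initial_segment[OF summable_diag[OF g B, of x], of N]
          by (simp add: diag_op_def y_def)
        moreover have "diag_op g c' 0 x =
            (\<Sum>n. (of_real (c (n + N)) * cinner x (g (n + N))) *\<^sub>C g (n + N))"
          using suminf_split_initial_segment[OF summable_diag[OF g B', of x], of N]
          by (simp add: diag_op_def c'_def complex_vector.scale_zero_left)
        ultimately show ?thesis by simp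
      qed
      moreover have "norm (diag_op g c' 0 x) \<le> e / 2 * norm x"
        (is "_ \<le> ?r")
        by (rule norm_diag_op_0_le[OF g]) (use N e in \<open>auto simp: c'_def less_imp_le not_less\<close>)
      moreover have "?r \<le> e / 2"
        using that e by (simp add: mult_left_le)
      ultimately show "dist (diag_op g c 0 x) y < e"
        using e by (simp only: dist_norm)
    qed
    then show "\<exists>S. compact S \<and> (\<forall>x\<in>diag_op g c 0 ` cball 0 1. \<exists>y\<in>S. dist x y < e)"
      using S(1) by (auto intro!: exI[of _ S])
  qed
  then show ?thesis
    by (simp add: compact_operator_def bounded_clinear_diag_op[OF g B])
qed

text \<open>The range is exactly the span of the \<open>g n\<close> with nonzero eigenvalue: each
  such \<open>g n\<close> is the image of \<open>(1 / c n) *\<^sub>R g n\<close>.\<close>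

lemma finite_rank_operator_diag_op_0:
  assumes g: "corthonormal UNIV g" and fin: "finite {n. c n \<noteq> 0}"
  shows "finite_rank_operator (diag_op g c 0)"
proof -
  let ?I = "{n. c n \<noteq> 0}"
  have B: "Bseq c"
    using finite_imageI[OF fin, of "\<lambda>n. \<bar>c n\<bar>"]
    by (intro BseqI'[of _ "Max (insert 0 ((\<lambda>n. \<bar>c n\<bar>) ` ?I))"])
      (auto intro!: Max_ge simp: image_iff)
  have eq: "diag_op g c 0 x = (\<Sum>n\<in>?I. (of_real (c n) * cinner x (g n)) *\<^sub>C g n)" for x
    unfolding diag_op_def
    by (subst suminf_finite[OF fin]) (auto simp: complex_vector.scale_zero_left)
  note lin = bounded_clinear_diag_op[OF g B, of 0]
  have "cspan (g ` ?I) = range (diag_op g c 0)"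
  proof
    show "range (diag_op g c 0) \<subseteq> cspan (g ` ?I)"
    proof (rule image_subsetI)
      fix x
      show "diag_op g c 0 x \<in> cspan (g ` ?I)"
        unfolding eq
        by (rule complex_vector.span_sum, rule complex_vector.span_scale,
            rule complex_vector.span_base) simp
    qed
    have "csubspace (range (diag_op g c 0))"
      by (rule csubspace_range[OF lin])
    moreover have "g n \<in> range (diag_op g c 0)" if "c n \<noteq> 0" for n
    proof -
      have "diag_op g c 0 ((1 / c n) *\<^sub>R g n) = g n"
      proof (rule diag_ext[OF g])
        show "cinner (diag_op g c 0 ((1 / c n) *\<^sub>R g n)) (g k) = cinner (g n) (g k)" for k
          using that
          by (cases "n = k")
            (simp_all add: cinner_diag_op_basis[OF g B] cinner_scaleR_left corthonormalD[OF g])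
        show "cinner (diag_op g c 0 ((1 / c n) *\<^sub>R g n)) v = cinner (g n) v"
          if "v \<in> cortho_complement (range g)" for v
          using that cinner_commute[of "g n" v]
          by (simp add: cinner_diag_op_cortho[OF g B that] cortho_complement_def)
      qed
      then show ?thesis by (metis rangeI)
    qed
    ultimately show "cspan (g ` ?I) \<subseteq> range (diag_op g c 0)"
      by (intro complex_vector.span_minimal) auto
  qed
  then have "cfinite_dim (range (diag_op g c 0))"
    using fin unfolding cfinite_dim_def by blast
  with lin show ?thesis by (simp add: finite_rank_operator_def)
qed

subsection \<open>Uniqueness of positive square roots\<close>

text \<open>Polarization expresses \<open>inner (D x) y\<close> through the quadratic form at
  \<open>x + y\<close> and \<open>x - y\<close>, and the parallelogram law bounds the
  result.\<close>

lemma symmetric_norm_le_numerical_radius: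
  fixes D :: "'a::real_inner \<Rightarrow> 'a"
  assumes D: "bounded_linear D" and sym: "\<And>x y. inner (D x) y = inner x (D y)"
    and r: "\<And>x. \<bar>inner (D x) x\<bar> \<le> r * (norm x)\<^sup>2"
  shows "norm (D x) \<le> r * norm x"
proof (cases "x = 0 \<or> D x = 0")
  case True
  have "0 \<le> r * norm x" if "x \<noteq> 0"
    using order_trans[OF abs_ge_zero r[of x]] that by (simp add: zero_le_mult_iff)
  with True linear_simps(3)[OF D] show ?thesis by (cases "x = 0") auto
next
  case False
  interpret D: bounded_linear D by fact
  \<comment> \<open>The direction of \<open>D x\<close> rescaled to the length of \<open>x\<close>:
    then \<open>inner (D x) y = norm x * norm (D x)\<close>, and both vectors contribute equally to
    the bound.\<close>
  define y where "y = (norm x / norm (D x)) *\<^sub>R D x"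
  have "4 * inner (D x) y = inner (D (x + y)) (x + y) - inner (D (x - y)) (x - y)"
    using sym[of x y] by (simp add: D.add D.diff inner_simps inner_commute)
  also have "\<dots> \<le> r * (norm (x + y))\<^sup>2 + r * (norm (x - y))\<^sup>2"
    using r[of "x + y"] r[of "x - y"] by linarith
  also have "\<dots> = r * (2 * (norm x)\<^sup>2 + 2 * (norm y)\<^sup>2)"
    by (simp add: power2_norm_eq_inner inner_simps inner_commute algebra_simps)
  also have "norm y = norm x" using False by (simp add: y_def)
  also have "inner (D x) y = norm x * norm (D x)"
    using False by (simp add: y_def power2_norm_eq_inner[symmetric] power2_eq_square)
  finally show ?thesis using False by (simp add: power2_eq_square)
qed

text \<open>An approximate eigenvector \<open>u\<close> of \<open>D = P - Q\<close> for the eigenvalue \<open>\<plusminus> onorm D\<close> exists. As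
  \<open>\<langle>(P + Q) u, D u\<rangle> = \<parallel>P u\<parallel>\<^sup>2 - \<parallel>Q u\<parallel>\<^sup>2 = 0\<close>, it makes
  \<open>onorm D * \<langle>(P + Q) u, u\<rangle>\<close> small, whereas \<open>\<langle>(P + Q) u, u\<rangle> \<ge> \<bar>\<langle>D u, u\<rangle>\<bar>\<close> is close to
  \<open>onorm D\<close>.\<close>

lemma positive_symmetric_eq_of_norm_eq:
  fixes P Q :: "'a::real_inner \<Rightarrow> 'a"
  assumes P: "bounded_linear P" "\<And>x y. inner (P x) y = inner x (P y)" "\<And>x. inner (P x) x \<ge> 0"
    and Q: "bounded_linear Q" "\<And>x y. inner (Q x) y = inner x (Q y)" "\<And>x. inner (Q x) x \<ge> 0"
    and eq: "\<And>x. norm (P x) = norm (Q x)"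
  shows "P = Q"
proof (rule ccontr)
  assume "P \<noteq> Q"
  define D where "D x = P x - Q x" for x
  define Y where "Y x = P x + Q x" for x
  have bD: "bounded_linear D" and bY: "bounded_linear Y"
    unfolding D_def Y_def using P(1) Q(1) by (intro bounded_linear_sub bounded_linear_add; simp)+
  have symD: "inner (D x) y = inner x (D y)" for x y
    by (simp add: D_def inner_simps P(2) Q(2))
  define r C where "r = onorm D" and "C = onorm Y"
  have C: "C \<ge> 0" "norm (Y x) \<le> C * norm x" for x
    unfolding C_def using onorm_pos_le[OF bY] onorm[OF bY] by auto
  have r: "norm (D x) \<le> r * norm x" for x unfolding r_def by (rule onorm[OF bD])
  have "\<exists>x. D x \<noteq> 0" using \<open>P \<noteq> Q\<close> by (auto simp: D_def)
  then have r0: "r > 0"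
    unfolding r_def using onorm_pos_lt[OF bD] by blast
  \<comment> \<open>A relative error small enough for the final contradiction:
    \<open>s \<le> 1 / 4\<close> keeps \<open>(1 - s)\<^sup>2\<close> at least 9/16, while
    \<open>4 * (C\<^sup>2 * s) \<le> r\<^sup>2\<close> makes the competing upper bound at most
    \<open>r\<^sup>2 / 2\<close>.\<close>
  define s where "s = r\<^sup>2 / (4 * (C\<^sup>2 + r\<^sup>2))"
  have pos: "C\<^sup>2 + r\<^sup>2 > 0" using r0 by (simp add: add_nonneg_pos)
  have s: "0 < s" "s \<le> 1 / 4" "4 * (C\<^sup>2 * s) \<le> r\<^sup>2"
    using r0 pos by (simp_all add: s_def field_simps)
  \<comment> \<open>Otherwise the numerical radius bound would push the operator norm of
    \<open>D\<close> below \<open>r\<close>.\<close>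
  have "\<exists>x. \<not> \<bar>inner (D x) x\<bar> \<le> (r - r * s) * (norm x)\<^sup>2"
  proof (rule ccontr)
    assume "\<not> ?thesis"
    then have "norm (D x) \<le> (r - r * s) * norm x" for x
      by (intro symmetric_norm_le_numerical_radius bD symD) auto
    then have "onorm D \<le> r - r * s" using r0 s by (intro onorm_bound) auto
    moreover have "r * s > 0" using r0 s by simp
    ultimately show False by (simp add: r_def[symmetric])
  qed
  then obtain x where x: "\<bar>inner (D x) x\<bar> > (r - r * s) * (norm x)\<^sup>2"
    using not_le by blast
  then have x0: "x \<noteq> 0" by (auto simp: linear_simps(3)[OF bD])
  define u where "u = (1 / norm x) *\<^sub>R x"
  have u: "norm u = 1" using x0 by (simp add: u_def)
  have Du: "\<bar>inner (D u) u\<bar> > r - r * s"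
    using x x0 by (simp add: u_def linear_simps(5)[OF bD] abs_mult field_simps power2_eq_square)
  \<comment> \<open>The approximate eigenvalue, \<open>r\<close> or \<open>- r\<close> according to
    the sign of the quadratic form at \<open>u\<close>.\<close>
  define \<delta> where "\<delta> = r * sgn (inner (D u) u)"
  have rs: "r - r * s \<ge> 0" using r0 s by simp
  then have "inner (D u) u \<noteq> 0" using Du by auto
  then have \<delta>: "\<delta> * inner (D u) u = r * \<bar>inner (D u) u\<bar>" "\<delta>\<^sup>2 = r\<^sup>2" "\<bar>\<delta>\<bar> = r"
    using r0 by (auto simp: \<delta>_def sgn_if abs_mult)
  have "(norm (\<delta> *\<^sub>R u - D u))\<^sup>2 = \<delta>\<^sup>2 * (norm u)\<^sup>2 - 2 * (\<delta> * inner (D u) u) + (norm (D u))\<^sup>2"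
    by (simp add: power2_norm_eq_inner inner_simps inner_commute power2_eq_square[of \<delta>] algebra_simps)
  also have "\<dots> \<le> r\<^sup>2 - 2 * (r * (r - r * s)) + r\<^sup>2"
  proof -
    have "r * (r - r * s) \<le> r * \<bar>inner (D u) u\<bar>" using Du r0 by (intro mult_left_mono) auto
    moreover have "(norm (D u))\<^sup>2 \<le> r\<^sup>2" using r[of u] u by (intro power_mono) auto
    moreover have "\<delta>\<^sup>2 * (norm u)\<^sup>2 = r\<^sup>2" by (simp add: u \<delta>)
    ultimately show ?thesis using \<delta>(1) by linarith
  qed
  also have "\<dots> = 2 * r\<^sup>2 * s" by (simp add: power2_eq_square algebra_simps)
  finally have small: "(norm (\<delta> *\<^sub>R u - D u))\<^sup>2 \<le> 2 * r\<^sup>2 * s" .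
  have "inner (Y u) (D u) = (norm (P u))\<^sup>2 - (norm (Q u))\<^sup>2"
    by (simp add: Y_def D_def power2_norm_eq_inner inner_simps inner_commute)
  then have "\<delta> * inner (Y u) u = inner (Y u) (\<delta> *\<^sub>R u - D u)"
    using eq[of u] by (simp add: inner_simps)
  moreover have "inner (Y u) u \<ge> \<bar>inner (D u) u\<bar>"
    using P(3)[of u] Q(3)[of u] by (simp add: Y_def D_def inner_simps)
  ultimately have "r * (r - r * s) \<le> \<bar>inner (Y u) (\<delta> *\<^sub>R u - D u)\<bar>"
    using Du \<delta>(3) r0 by (metis abs_ge_self abs_mult less_imp_le mult_left_mono order_trans)
  also have "\<dots> \<le> norm (Y u) * norm (\<delta> *\<^sub>R u - D u)" by (rule Cauchy_Schwarz_ineq2)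
  also have "\<dots> \<le> C * norm (\<delta> *\<^sub>R u - D u)"
    using C(2)[of u] u by (intro mult_right_mono) auto
  finally have "(r * (r - r * s))\<^sup>2 \<le> (C * norm (\<delta> *\<^sub>R u - D u))\<^sup>2"
    using r0 rs by (intro power_mono) auto
  also have "\<dots> \<le> C\<^sup>2 * (2 * r\<^sup>2 * s)"
    unfolding power_mult_distrib using small by (intro mult_left_mono) auto
  also have "\<dots> = r\<^sup>2 * (2 * (C\<^sup>2 * s))" by simp
  also have "(r * (r - r * s))\<^sup>2 = r\<^sup>2 * (r\<^sup>2 * (1 - s)\<^sup>2)"
    by (simp add: power2_eq_square algebra_simps)
  finally have "r\<^sup>2 * (1 - s)\<^sup>2 \<le> 2 * (C\<^sup>2 * s)"
    by (rule mult_left_le_imp_le) (use r0 in simp)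
  moreover have "(3 / 4)\<^sup>2 \<le> (1 - s)\<^sup>2" using s by (intro power_mono) auto
  then have "r\<^sup>2 * (9 / 16) \<le> r\<^sup>2 * (1 - s)\<^sup>2"
    by (intro mult_left_mono) (auto simp: power2_eq_square)
  ultimately have "r\<^sup>2 * (9 / 16) \<le> r\<^sup>2 / 2" using s(3) by linarith
  then show False using r0 by simp
qed

subsection \<open>Positive, compact and finite rank operators\<close>

lemma positive_operator_bounded_clinear: "positive_operator S \<Longrightarrow> bounded_clinear S"
  by (simp add: positive_operator_def)

lemma positive_operator_inner_nonneg: "positive_operator S \<Longrightarrow> inner (S x) x \<ge> 0"
  by (simp add: positive_operator_def inner_eq_Re_cinner complex_nonneg_Reals_iff)

text \<open>Symmetry is derived by polarization, since \<open>S = cadjoint S\<close> alone says nothing before an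
  adjoint is known to exist.\<close>

lemma positive_operator_cinner_commute:
  assumes S: "positive_operator S"
  shows "cinner (S x) y = cinner x (S y)"
proof -
  have lin: "bounded_linear S" "\<And>c x. S (c *\<^sub>C x) = c *\<^sub>C S x"
    using S by (auto simp: positive_operator_def bounded_clinear_def)
  have Im0: "Im (cinner (S x) x) = 0" for x
    using S by (simp add: positive_operator_def complex_nonneg_Reals_iff)
  have 1: "Im (cinner (S x) y) + Im (cinner (S y) x) = 0" for x y
    using Im0[of "x + y"] Im0[of x] Im0[of y] by (simp add: linear_simps(1)[OF lin(1)] cinner_simps)
  \<comment> \<open>Replacing \<open>x\<close> by \<open>\<i> *\<^sub>C x\<close> turns the relation
    between imaginary parts into one between real parts.\<close>
  have 2: "Re (cinner (S x) y) = Re (cinner (S y) x)"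
    using 1[of "\<i> *\<^sub>C x" y] by (simp add: lin(2) cinner_simps)
  have "cinner x (S y) = cnj (cinner (S y) x)" by (rule cinner_commute)
  then show ?thesis using 1[of x y] 2 by (simp add: complex_eq_iff)
qed

lemma positive_operator_inner_commute:
  "positive_operator S \<Longrightarrow> inner (S x) y = inner x (S y)"
  by (simp add: inner_eq_Re_cinner positive_operator_cinner_commute)

text \<open>\<open>S\<close> itself witnesses that an adjoint exists, and nondegeneracy forces the
  chosen adjoint to agree with it.\<close>

lemma cadjoint_symmetric:
  assumes "\<And>x y. cinner (S x) y = cinner x (S y)"
  shows "S = cadjoint S"
proof -
  have "\<forall>x y. cinner (S x) y = cinner x (cadjoint S y)"
    unfolding cadjoint_def by (rule someI[of _ S]) (use assms in blast)
  then have "cinner x (S y - cadjoint S y) = 0" for x y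
    using assms by (simp add: cinner_diff_right)
  then have "S y - cadjoint S y = 0" for y using cinner_eq_0_self by blast
  then show ?thesis by (simp add: fun_eq_iff)
qed

lemma positive_operator_contraction:
  fixes K :: "'a::complex_inner \<Rightarrow> 'a"
  assumes K: "positive_operator K" and le: "\<And>x. norm (K x) \<le> \<alpha> * norm x" and \<alpha>: "\<alpha> \<ge> 0"
  shows "norm (\<alpha> *\<^sub>R x - K x) \<le> \<alpha> * norm x"
    and "inner (\<alpha> *\<^sub>R x - K x) x \<ge> 0"
proof -
  interpret K: bounded_linear K
    using K by (simp add: positive_operator_def bounded_clinear_def)
  note sym = positive_operator_inner_commute[OF K]
  \<comment> \<open>This is K^2 \<le> \<alpha> K as quadratic forms, obtained from positivity of
    \<open>K\<close> at the vector \<open>\<alpha> *\<^sub>R x - K x\<close>.\<close>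
  have main: "(norm (K x))\<^sup>2 \<le> \<alpha> * inner (K x) x"
  proof (cases "\<alpha> = 0")
    case True
    then show ?thesis using le[of x] by simp
  next
    case False
    have "0 \<le> inner (K (\<alpha> *\<^sub>R x - K x)) (\<alpha> *\<^sub>R x - K x)"
      by (rule positive_operator_inner_nonneg[OF K])
    also have "\<dots> = \<alpha>\<^sup>2 * inner (K x) x - 2 * \<alpha> * (norm (K x))\<^sup>2 + inner (K (K x)) (K x)"
      using sym[of "K x" x]
      by (simp add: K.diff K.scaleR inner_simps power2_norm_eq_inner power2_eq_square[of \<alpha>]
          algebra_simps)
    also have "inner (K (K x)) (K x) \<le> norm (K (K x)) * norm (K x)" by (rule norm_cauchy_schwarz)
    also have "\<dots> \<le> \<alpha> * norm (K x) * norm (K x)"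
      by (rule mult_right_mono[OF le norm_ge_zero])
    also have "\<dots> = \<alpha> * (norm (K x))\<^sup>2" by (simp add: power2_eq_square)
    finally have "0 \<le> \<alpha> * (\<alpha> * inner (K x) x - (norm (K x))\<^sup>2)"
      by (simp add: power2_eq_square[of \<alpha>] algebra_simps)
    then show ?thesis using False \<alpha> by (simp add: zero_le_mult_iff)
  qed
  have "(norm (\<alpha> *\<^sub>R x - K x))\<^sup>2 = (\<alpha> * norm x)\<^sup>2 - 2 * (\<alpha> * inner (K x) x) + (norm (K x))\<^sup>2"
    unfolding power_mult_distrib
    by (simp add: power2_norm_eq_inner inner_simps inner_commute power2_eq_square[of \<alpha>] algebra_simps)
  also have "\<dots> \<le> (\<alpha> * norm x)\<^sup>2"
    using main zero_le_power2[of "norm (K x)"] by linarith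
  finally show "norm (\<alpha> *\<^sub>R x - K x) \<le> \<alpha> * norm x"
    by (rule power2_le_imp_le) (simp add: \<alpha>)
  have "inner (K x) x \<le> norm (K x) * norm x" by (rule norm_cauchy_schwarz)
  also have "\<dots> \<le> \<alpha> * norm x * norm x"
    by (rule mult_right_mono[OF le norm_ge_zero])
  also have "\<dots> = \<alpha> * (norm x)\<^sup>2" by (simp add: power2_eq_square)
  finally show "inner (\<alpha> *\<^sub>R x - K x) x \<ge> 0"
    by (simp add: inner_simps power2_norm_eq_inner)
qed

section \<open>Finite rank and compactness along sequences\<close>

lemma bounded_cspan_subset_compact:
  assumes "finite (B :: 'a::complex_inner set)"
  shows "\<exists>S. compact S \<and> cspan B \<inter> cball 0 r \<subseteq> S"
proof -
  obtain A where A: "finite A" "corthonormal A (\<lambda>x. x)"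
    and B: "\<And>x. x \<in> cspan B \<Longrightarrow> x = (\<Sum>a\<in>A. cinner x a *\<^sub>C a)"
    using finite_corthonormal_basis_exists[OF assms] by blast
  obtain S where S: "compact S" "\<And>f. (\<forall>a\<in>A. cmod (f a) \<le> r) \<Longrightarrow> (\<Sum>a\<in>A. f a *\<^sub>C a) \<in> S"
    using compact_finite_combinations[OF A(1), of r "\<lambda>x. x"] by blast
  have "x \<in> S" if x: "x \<in> cspan B" "norm x \<le> r" for x
  proof -
    have "cmod (cinner x a) \<le> r" if "a \<in> A" for a
      using norm_cinner_le[of x a] corthonormal_norm[OF A(2) that] x(2) by simp
    then show ?thesis using B[OF x(1)] S(2)[of "cinner x"] by simp
  qed
  then show ?thesis using S(1) by (intro exI[of _ S]) auto
qed

lemma finite_rank_operator_compact: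
  assumes F: "finite_rank_operator F"
  shows "compact_operator F"
proof -
  have lin: "bounded_clinear F" using F by (simp add: finite_rank_operator_def)
  obtain B where B: "finite B" "cspan B = range F"
    using F by (auto simp: finite_rank_operator_def cfinite_dim_def)
  obtain S where S: "compact S" "cspan B \<inter> cball 0 (onorm F) \<subseteq> S"
    using bounded_cspan_subset_compact[OF B(1)] by blast
  have "F ` cball 0 1 \<subseteq> S"
  proof (rule image_subsetI)
    fix x :: 'a assume "x \<in> cball 0 1"
    then have "norm (F x) \<le> onorm F"
      using onorm[OF bounded_clinear_bounded_linear[OF lin], of x]
        onorm_pos_le[OF bounded_clinear_bounded_linear[OF lin]]
      by (simp add: mult_left_le order_trans)
    then show "F x \<in> S" using S(2) B(2) by auto
  qed
  then have "closure (F ` cball 0 1) \<inter> S = closure (F ` cball 0 1)"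
    using S(1) closure_minimal compact_imp_closed by blast
  then show ?thesis
    using closed_Int_compact[OF closed_closure[of "F ` cball 0 1"] S(1)] lin
    by (simp add: compact_operator_def)
qed

text \<open>In this subsequence form, stability under differences is a matter of extracting a
  subsequence twice.\<close>

definition seq_compact_map :: "('a::real_normed_vector \<Rightarrow> 'b::real_normed_vector) \<Rightarrow> bool"
  where "seq_compact_map f \<longleftrightarrow> (\<forall>x :: nat \<Rightarrow> 'a. (\<forall>n. norm (x n) \<le> 1) \<longrightarrow>
    (\<exists>r. strict_mono (r :: nat \<Rightarrow> nat) \<and> convergent (\<lambda>n. f (x (r n)))))"

lemma seq_compact_mapE:
  assumes "seq_compact_map f" "\<And>n. norm (x n) \<le> 1"
  obtains r :: "nat \<Rightarrow> nat" where "strict_mono r" "convergent (\<lambda>n. f (x (r n)))"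
  using assms unfolding seq_compact_map_def by metis

lemma compact_operator_seq_compact_map:
  assumes "compact_operator f"
  shows "seq_compact_map f"
  unfolding seq_compact_map_def
proof (intro allI impI)
  fix x :: "nat \<Rightarrow> 'a" assume "\<forall>n. norm (x n) \<le> 1"
  then have x: "\<forall>n. f (x n) \<in> closure (f ` cball 0 1)"
    using closure_subset[of "f ` cball 0 1"] by auto
  have "seq_compact (closure (f ` cball 0 1))"
    using assms by (simp add: compact_operator_def compact_imp_seq_compact)
  then obtain l r where "strict_mono (r :: nat \<Rightarrow> nat)" "((\<lambda>n. f (x n)) \<circ> r) \<longlonglongrightarrow> l"
    using seq_compactE[of _ "\<lambda>n. f (x n)"] x by metis
  then show "\<exists>r. strict_mono r \<and> convergent (\<lambda>n. f (x (r n)))"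
    unfolding convergent_def o_def by blast
qed

lemma seq_compact_map_diff:
  assumes f: "seq_compact_map f" and g: "seq_compact_map g"
  shows "seq_compact_map (\<lambda>x. f x - g x)"
  unfolding seq_compact_map_def
proof (intro allI impI)
  fix x :: "nat \<Rightarrow> 'a" assume x: "\<forall>n. norm (x n) \<le> 1"
  then obtain r :: "nat \<Rightarrow> nat" where r: "strict_mono r" "convergent (\<lambda>n. f (x (r n)))"
    using seq_compact_mapE[OF f] by blast
  obtain s :: "nat \<Rightarrow> nat" where s: "strict_mono s" "convergent (\<lambda>n. g (x (r (s n))))"
    using seq_compact_mapE[OF g, of "\<lambda>n. x (r n)"] x by blast
  have "convergent (\<lambda>n. f (x (r (s n))))"
    using convergent_subseq_convergent[OF r(2) s(1)] by (simp add: o_def)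
  then have "convergent (\<lambda>n. f (x (r (s n))) - g (x (r (s n))))"
    using s(2) by (rule convergent_diff)
  then show "\<exists>r. strict_mono r \<and> convergent (\<lambda>n. f (x (r n)) - g (x (r n)))"
    using strict_mono_o[OF r(1) s(1)] by (intro exI[of _ "r \<circ> s"]) (simp add: o_def)
qed

text \<open>Distinct members of an orthonormal sequence are at distance \<open>sqrt 2\<close>, so no
  nonzero multiple of the sequence has a Cauchy subsequence. This is what makes \<alpha>
  unique.\<close>

lemma seq_compact_map_scaleR_imp_0:
  assumes inf: "\<not> cfinite_dim (UNIV :: 'a::complex_inner set)"
    and c: "seq_compact_map (\<lambda>x :: 'a. c *\<^sub>R x)"
  shows "c = 0"
proof (rule ccontr)
  assume "c \<noteq> 0"
  obtain f :: "nat \<Rightarrow> 'a" where f: "corthonormal UNIV f"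
    using corthonormal_sequence_exists[OF inf] by blast
  obtain r where r: "strict_mono r" "convergent (\<lambda>n. c *\<^sub>R f (r n))"
    using seq_compact_mapE[OF c, of f] corthonormal_norm[OF f] by auto
  then obtain l where "(\<lambda>n. c *\<^sub>R f (r n)) \<longlonglongrightarrow> l" unfolding convergent_def by blast
  then have "(\<lambda>n. inverse c *\<^sub>R (c *\<^sub>R f (r n))) \<longlonglongrightarrow> inverse c *\<^sub>R l" by (intro tendsto_intros)
  then have "convergent (\<lambda>n. f (r n))"
    using \<open>c \<noteq> 0\<close> unfolding convergent_def by auto
  then have "Cauchy (\<lambda>n. f (r n))" by (rule convergent_Cauchy)
  then obtain N where N: "\<And>m n. m \<ge> N \<Longrightarrow> n \<ge> N \<Longrightarrow> dist (f (r m)) (f (r n)) < 1"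
    using metric_CauchyD[of _ 1] by (metis zero_less_one)
  have ne: "r N \<noteq> r (Suc N)" using r(1) by (metis n_not_Suc_n strict_mono_eq)
  have "inner (f (r N)) (f (r (Suc N))) = 0"
    using corthonormalD[OF f, of "r N" "r (Suc N)"] ne by (simp add: inner_eq_Re_cinner)
  then have "(norm (f (r N) - f (r (Suc N))))\<^sup>2 = (norm (f (r N)))\<^sup>2 + (norm (f (r (Suc N))))\<^sup>2"
    by (simp add: power2_norm_eq_inner inner_simps inner_commute)
  also have "\<dots> = 2" by (simp add: corthonormal_norm[OF f])
  finally have "(norm (f (r N) - f (r (Suc N))))\<^sup>2 = 2" .
  moreover have "norm (f (r N) - f (r (Suc N))) < 1" using N[of N "Suc N"] by (simp add: dist_norm)
  then have "(norm (f (r N) - f (r (Suc N))))\<^sup>2 < 1" by (simp add: power_less_one_iff abs_square_less_1)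
  ultimately show False by simp
qed

lemma subspace_closure:
  fixes M :: "'a::real_normed_vector set"
  assumes M: "subspace M"
  shows "subspace (closure M)"
  unfolding subspace_def
proof (intro conjI ballI allI)
  show "0 \<in> closure M" using M closure_subset subspace_0 by blast
  show "x + y \<in> closure M" if xy: "x \<in> closure M" "y \<in> closure M" for x y
  proof -
    obtain a b where "\<forall>n. a n \<in> M" "a \<longlonglongrightarrow> x" "\<forall>n. b n \<in> M" "b \<longlonglongrightarrow> y"
      using xy by (auto simp: closure_sequential)
    then have "\<forall>n. a n + b n \<in> M" "(\<lambda>n. a n + b n) \<longlonglongrightarrow> x + y"
      using M by (auto intro: subspace_add tendsto_add)
    then show ?thesis by (auto simp: closure_sequential)
  qed
  show "c *\<^sub>R x \<in> closure M" if x: "x \<in> closure M" for c x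
  proof -
    obtain a where "\<forall>n. a n \<in> M" "a \<longlonglongrightarrow> x" using x by (auto simp: closure_sequential)
    then have "\<forall>n. c *\<^sub>R a n \<in> M" "(\<lambda>n. c *\<^sub>R a n) \<longlonglongrightarrow> c *\<^sub>R x"
      using M by (auto intro: subspace_scale tendsto_scaleR)
    then show ?thesis by (auto simp: closure_sequential)
  qed
qed

subsection \<open>Operators with a decomposition\<close>

lemma minimum_attaining_of_convergent:
  assumes M: "closed M" and T: "bounded_linear T"
    and y: "\<And>n. y n \<in> M" "\<And>n. norm (y n) = 1" and conv: "convergent y"
    and lim: "(\<lambda>n. norm (T (y n))) \<longlonglongrightarrow> min_modulus_on M T"
  shows "minimum_attaining_on M T"
proof -
  obtain l where l: "y \<longlonglongrightarrow> l" using conv convergent_def by blast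
  have "l \<in> M" using closed_sequentially[OF M y(1) l] .
  moreover have "norm l = 1"
    using tendsto_norm[OF l] y(2) by (simp add: LIMSEQ_const_iff)
  moreover have "norm (T l) = min_modulus_on M T"
    using LIMSEQ_unique[OF tendsto_norm[OF bounded_linear.tendsto[OF T l]] lim] by simp
  ultimately show ?thesis by (auto simp: minimum_attaining_on_def)
qed

context
  fixes T V :: "'a::chilbert_space \<Rightarrow> 'b::chilbert_space" and \<alpha> K F
  assumes dec: "AM_decomposition T V \<alpha> K F"
begin

text \<open>The absolute value |T|, that is, the positive square root of T*T, as the following
  lemmas confirm.\<close>

abbreviation (input) modulus where "modulus x \<equiv> \<alpha> *\<^sub>R x - K x + F x"

lemma AM_decompositionD:
  shows "T x = V (modulus x)" and "\<alpha> \<ge> 0"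
    and "positive_operator K" and "compact_operator K"
    and "positive_operator F" and "finite_rank_operator F"
    and "K (F x) = 0" and "F (K x) = 0"
    and "partial_isometry V" and "V x = 0 \<longleftrightarrow> modulus x = 0"
  using dec by (auto simp: AM_decomposition_def fun_eq_iff null_space_def set_eq_iff)

lemma AM_decomposition_K_le: "norm (K x) \<le> \<alpha> * norm x"
proof -
  have "bounded_linear K" "onorm K \<le> \<alpha>"
    using dec by (auto simp: AM_decomposition_def compact_operator_def bounded_clinear_def)
  then show ?thesis
    using onorm[of K x] by (meson mult_right_mono norm_ge_zero order_trans)
qed

lemma AM_decomposition_seq_compact: "seq_compact_map K" "seq_compact_map F"
  using AM_decompositionD(4,6)
  by (auto intro: compact_operator_seq_compact_map finite_rank_operator_compact)

lemma modulus_bounded_clinear: "bounded_clinear modulus"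
proof -
  have "bounded_clinear K" "bounded_clinear F"
    using AM_decompositionD(3,5) by (auto simp: positive_operator_def)
  then have "bounded_linear modulus" "modulus (c *\<^sub>C x) = c *\<^sub>C modulus x" for c x
    by (auto intro!: bounded_linear_add bounded_linear_sub bounded_linear_scaleR_right
        dest: bounded_clinear_bounded_linear)
      (simp add: bounded_clinear_scaleC scaleR_scaleC scaleC_scaleC mult.commute
        complex_vector.scale_right_diff_distrib scaleC_add_right)
  then show ?thesis by (simp add: bounded_clinear_def)
qed

lemma modulus_cinner_commute: "cinner (modulus x) y = cinner x (modulus y)"
  using AM_decompositionD(3,5)
  by (simp add: cinner_simps positive_operator_cinner_commute)

lemma modulus_inner_commute: "inner (modulus x) y = inner x (modulus y)"
  by (simp only: inner_eq_Re_cinner modulus_cinner_commute)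

lemma modulus_inner_nonneg: "inner (modulus x) x \<ge> 0"
proof -
  have "inner (\<alpha> *\<^sub>R x - K x) x \<ge> 0"
    using AM_decompositionD(2,3) AM_decomposition_K_le
    by (intro positive_operator_contraction(2))
  then show ?thesis
    using positive_operator_inner_nonneg[OF AM_decompositionD(5), of x]
    by (simp add: inner_add_left)
qed

text \<open>By symmetry the range of the modulus is orthogonal to its null space, which is also that
  of \<open>V\<close>; on that orthocomplement \<open>V\<close> is isometric.\<close>

lemma norm_T_eq_modulus: "norm (T x) = norm (modulus x)"
proof -
  have "modulus x \<in> cortho_complement (null_space V)"
    unfolding cortho_complement_def null_space_def
    using AM_decompositionD(10) by (auto simp: modulus_cinner_commute)
  then show ?thesis
    using AM_decompositionD(1,9) by (auto simp: partial_isometry_def)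
qed

text \<open>The modulus is \<alpha> I + C with \<open>C = F - K\<close> compact. For differences
  \<open>z\<close> of terms of the sequence, the form \<open>q z\<close> tends to 0 and, along a
  subsequence, so does \<open>C z\<close>. What remains of \<open>q z\<close> is
  \<open>(\<alpha>\<^sup>2 - m\<^sup>2) * (norm z)\<^sup>2\<close> with nonzero coefficient, hence
  \<open>z\<close> tends to 0.\<close>

lemma modulus_minimizing_convergent_subsequence:
  assumes M: "csubspace M" and T: "bounded_linear T" and ne: "m \<noteq> \<alpha>" "m \<ge> 0"
    and lower: "\<And>x. x \<in> M \<Longrightarrow> m * norm x \<le> norm (T x)"
    and y: "\<And>n. y n \<in> M" "\<And>n. norm (y n) = 1"
    and lim: "(\<lambda>n. norm (T (y n))) \<longlonglongrightarrow> m"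
  shows "\<exists>r. strict_mono (r :: nat \<Rightarrow> nat) \<and> convergent (y \<circ> r)"
proof -
  interpret T: bounded_linear T by fact
  define C where "C x = F x - K x" for x
  have "seq_compact_map C"
    unfolding C_def
    by (intro seq_compact_map_diff AM_decomposition_seq_compact)
  then obtain r :: "nat \<Rightarrow> nat" where r: "strict_mono r" "convergent (\<lambda>n. C (y (r n)))"
    using seq_compact_mapE[of C y] y(2) by auto
  interpret C: bounded_linear C
    unfolding C_def using AM_decompositionD(3,5)
    by (intro bounded_linear_sub) (auto simp: positive_operator_def bounded_clinear_def)
  define c where "c = \<bar>\<alpha>\<^sup>2 - m\<^sup>2\<bar>"
  have c: "c > 0" using ne AM_decompositionD(2) by (auto simp: c_def power2_eq_iff_nonneg)
  define b where "b n = (norm (T (y (r n))))\<^sup>2 - m\<^sup>2" for n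
  have b_lim: "b \<longlonglongrightarrow> 0"
  proof -
    have "(\<lambda>n. norm (T (y (r n)))) \<longlonglongrightarrow> m" using LIMSEQ_subseq_LIMSEQ[OF lim r(1)] by (simp add: o_def)
    then have "b \<longlonglongrightarrow> m\<^sup>2 - m\<^sup>2" unfolding b_def by (intro tendsto_intros)
    then show ?thesis by simp
  qed
  define q where "q x = (norm (T x))\<^sup>2 - m\<^sup>2 * (norm x)\<^sup>2" for x
  have q0: "q x \<ge> 0" if "x \<in> M" for x
    using power_mono[OF lower[OF that], of 2] ne by (simp add: q_def power_mult_distrib)
  have qb: "q (y (r n)) = b n" for n using y(2) by (simp add: q_def b_def)
  have key: "c * (norm (y (r i) - y (r j)))\<^sup>2 \<le>
      4 * \<alpha> * norm (C (y (r i)) - C (y (r j))) + (norm (C (y (r i)) - C (y (r j))))\<^sup>2 + 2 * b i + 2 * b j"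
    for i j
  proof -
    define z where "z = y (r i) - y (r j)"
    \<comment> \<open>Parallelogram law for the quadratic form \<open>q\<close>; both terms on the
      left are nonnegative because their arguments lie in \<open>M\<close>.\<close>
    have "q z + q (y (r i) + y (r j)) = 2 * q (y (r i)) + 2 * q (y (r j))"
      by (simp add: q_def z_def T.diff T.add power2_norm_eq_inner inner_simps inner_commute algebra_simps)
    moreover have "z \<in> M" "y (r i) + y (r j) \<in> M"
      unfolding z_def using M y(1) by (simp_all add: csubspace_add csubspace_diff)
    ultimately have "\<bar>q z\<bar> \<le> 2 * b i + 2 * b j" using q0 qb by (smt (verit))
    moreover have "q z = (\<alpha>\<^sup>2 - m\<^sup>2) * (norm z)\<^sup>2 + 2 * \<alpha> * inner z (C z) + (norm (C z))\<^sup>2"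
    proof -
      have "norm (T z) = norm (\<alpha> *\<^sub>R z + C z)"
        unfolding norm_T_eq_modulus C_def by (simp add: algebra_simps)
      then show ?thesis
        by (simp add: q_def power2_norm_eq_inner inner_simps inner_commute
            power2_eq_square[of \<alpha>] algebra_simps)
    qed
    moreover have "\<bar>2 * \<alpha> * inner z (C z)\<bar> \<le> 4 * \<alpha> * norm (C z)"
    proof -
      have "norm z \<le> 2" using norm_triangle_ineq4[of "y (r i)" "y (r j)"] y(2) by (simp add: z_def)
      then have "\<bar>inner z (C z)\<bar> \<le> 2 * norm (C z)"
        using Cauchy_Schwarz_ineq2[of z "C z"] mult_right_mono[of "norm z" 2 "norm (C z)"] by simp
      then have "\<alpha> * \<bar>inner z (C z)\<bar> \<le> \<alpha> * (2 * norm (C z))"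
        using AM_decompositionD(2) by (rule mult_left_mono)
      then show ?thesis using AM_decompositionD(2) by (simp add: abs_mult)
    qed
    ultimately have "\<bar>(\<alpha>\<^sup>2 - m\<^sup>2) * (norm z)\<^sup>2\<bar> \<le>
        4 * \<alpha> * norm (C z) + (norm (C z))\<^sup>2 + 2 * b i + 2 * b j"
      by (smt (verit) zero_le_power2)
    then show ?thesis by (simp add: abs_mult c_def z_def C.diff)
  qed
  have "Cauchy (\<lambda>n. y (r n))"
  proof (rule metric_CauchyI)
    fix e :: real assume e: "e > 0"
    \<comment> \<open>If \<open>b i\<close>, \<open>b j\<close> and the norm in \<open>key\<close>
      are below \<open>d \<le> 1\<close>, the right side of \<open>key\<close> is less than
      \<open>(4 * \<alpha> + 6) * d\<close>.\<close>
    define d where "d = min 1 (c * e\<^sup>2 / (4 * \<alpha> + 6))"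
    have \<alpha>6: "4 * \<alpha> + 6 > 0" using AM_decompositionD(2) by simp
    have d: "d > 0" "d \<le> 1" using c e \<alpha>6 by (auto simp: d_def)
    have "d \<le> c * e\<^sup>2 / (4 * \<alpha> + 6)" by (simp add: d_def)
    then have d3: "(4 * \<alpha> + 6) * d \<le> c * e\<^sup>2" using \<alpha>6 by (simp add: le_divide_eq mult.commute)
    obtain N1 where N1: "\<And>i j. i \<ge> N1 \<Longrightarrow> j \<ge> N1 \<Longrightarrow> dist (C (y (r i))) (C (y (r j))) < d"
      using metric_CauchyD[OF convergent_Cauchy[OF r(2)] d(1)] by blast
    obtain N2 where N2: "\<And>i. i \<ge> N2 \<Longrightarrow> \<bar>b i\<bar> < d"
      using LIMSEQ_D[OF b_lim d(1)] by auto
    have "dist (y (r i)) (y (r j)) < e" if ij: "i \<ge> max N1 N2" "j \<ge> max N1 N2" for i j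
    proof -
      define w where "w = norm (C (y (r i)) - C (y (r j)))"
      have w: "w < d" "w \<ge> 0" using N1[of i j] ij by (simp_all add: w_def dist_norm)
      have "\<alpha> * w \<le> \<alpha> * d" using w AM_decompositionD(2) by (intro mult_left_mono) auto
      moreover have "w\<^sup>2 \<le> d"
      proof -
        have "w\<^sup>2 \<le> w" using w d by (simp add: power2_eq_square mult_left_le)
        then show ?thesis using w by simp
      qed
      moreover have "b i < d" "b j < d" using N2[of i] N2[of j] ij by auto
      ultimately have "c * (norm (y (r i) - y (r j)))\<^sup>2 < (4 * \<alpha> + 6) * d"
        using key[of i j] d(1) unfolding w_def[symmetric] by (simp add: algebra_simps)
      then have "c * (norm (y (r i) - y (r j)))\<^sup>2 < c * e\<^sup>2" using d3 by simp
      then have "(norm (y (r i) - y (r j)))\<^sup>2 < e\<^sup>2" using c by simp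
      then show ?thesis using e by (simp add: dist_norm power_less_imp_less_base)
    qed
    then show "\<exists>N. \<forall>i\<ge>N. \<forall>j\<ge>N. dist (y (r i)) (y (r j)) < e" by blast
  qed
  then show ?thesis
    using r(1) Cauchy_convergent by (intro exI[of _ r]) (simp add: o_def)
qed

text \<open>\<open>F\<close> is injective on \<open>M\<close> and has finite rank, so
  \<open>M\<close> is finite dimensional and its unit ball lies in a compact set.\<close>

lemma kernel_free_subspace_convergent_subsequence:
  assumes M: "csubspace M" and ker: "\<And>x. x \<in> M \<Longrightarrow> F x = 0 \<Longrightarrow> x = 0"
    and y: "\<And>n. y n \<in> M" "\<And>n. norm (y n) = 1"
  shows "\<exists>r. strict_mono (r :: nat \<Rightarrow> nat) \<and> convergent (y \<circ> r)"
proof -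
  interpret vector_space_pair "scaleC :: complex \<Rightarrow> 'a \<Rightarrow> 'a" "scaleC :: complex \<Rightarrow> 'a \<Rightarrow> 'a"
    by unfold_locales
  have linF: "bounded_clinear F" "bounded_linear F"
    using AM_decompositionD(5) by (auto simp: positive_operator_def bounded_clinear_def)
  obtain E where E: "finite E" "cspan E = range F"
    using AM_decompositionD(6) by (auto simp: finite_rank_operator_def cfinite_dim_def)
  \<comment> \<open>An algebraic basis of \<open>M\<close>. Its image under \<open>F\<close> is
    independent inside a finitely spanned space, so it is finite.\<close>
  obtain B where B: "B \<subseteq> M" "complex_vector.independent B" "M \<subseteq> cspan B"
    using complex_vector.maximal_independent_subset[of M] by blast
  have span: "cspan B \<subseteq> M" by (rule complex_vector.span_minimal[OF B(1) M])
  have clin: "Vector_Spaces.linear scaleC scaleC F"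
    unfolding Vector_Spaces.linear_iff
    by (simp add: linear_simps(1)[OF linF(2)] bounded_clinear_scaleC[OF linF(1)]
        complex_vector.vector_space_axioms)
  have inj: "inj_on F (cspan B)"
  proof (rule inj_onI)
    fix u v assume uv: "u \<in> cspan B" "v \<in> cspan B" "F u = F v"
    then have "u - v \<in> M" using span M csubspace_diff by blast
    then show "u = v" using ker[of "u - v"] uv(3) by (simp add: linear_simps(2)[OF linF(2)])
  qed
  have "complex_vector.independent (F ` B)"
    using linear_independent_injective_image[OF clin B(2) inj[unfolded cspan_def]] .
  moreover have "F ` B \<subseteq> cspan E" using E(2) by auto
  ultimately have "finite (F ` B)"
    using complex_vector.independent_span_bound[OF E(1)] by blast
  then have "finite B"
    using finite_imageD inj_on_subset[OF inj complex_vector.span_superset] by blast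
  then obtain S where S: "compact S" "cspan B \<inter> cball 0 1 \<subseteq> S"
    using bounded_cspan_subset_compact by blast
  have "\<forall>n. y n \<in> S" using y B(3) S(2) by (simp add: subset_iff)
  then show ?thesis
    using seq_compactE[of S y] compact_imp_seq_compact[OF S(1)] unfolding convergent_def by metis
qed

lemma AM_decomposition_minimum_attaining:
  assumes M: "csubspace M" "closed M" "M \<noteq> {0}" and T: "bounded_linear T"
  shows "minimum_attaining_on M T"
proof -
  interpret T: bounded_linear T by fact
  define m where "m = min_modulus_on M T"
  let ?N = "{norm (T x) |x. x \<in> M \<and> norm x = 1}"
  obtain x0 where x0: "x0 \<in> M" "x0 \<noteq> 0" using M(1,3) csubspace_0 by blast
  have unit: "(1 / norm x) *\<^sub>R x \<in> M" if "x \<in> M" for x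
    using csubspace_scaleR[OF M(1) that] .
  have ne: "?N \<noteq> {}" using unit[OF x0(1)] x0(2) by (auto intro!: exI[of _ "(1 / norm x0) *\<^sub>R x0"])
  have bdd: "bdd_below ?N" by (rule bdd_belowI[of _ 0]) auto
  have m_le: "m \<le> norm (T x)" if "x \<in> M" "norm x = 1" for x
    unfolding m_def min_modulus_on_def using that by (intro cInf_lower bdd) auto
  have m0: "m \<ge> 0"
    unfolding m_def min_modulus_on_def by (intro cInf_greatest ne) auto
  have lower: "m * norm x \<le> norm (T x)" if "x \<in> M" for x
  proof (cases "x = 0")
    case False
    then show ?thesis
      using m_le[OF unit[OF that]] by (simp add: T.scaleR field_simps)
  qed simp
  have "\<exists>x. x \<in> M \<and> norm x = 1 \<and> norm (T x) < m + 1 / real (Suc n)" for n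
  proof -
    have "Inf ?N < m + 1 / real (Suc n)" by (simp add: m_def min_modulus_on_def)
    then show ?thesis by (subst (asm) cInf_less_iff[OF ne bdd]) auto
  qed
  then obtain y where y: "\<And>n. y n \<in> M" "\<And>n. norm (y n) = 1"
    "\<And>n. norm (T (y n)) < m + 1 / real (Suc n)" by metis
  have lim: "(\<lambda>n. norm (T (y n))) \<longlonglongrightarrow> m"
  proof (rule tendsto_sandwich[OF _ _ tendsto_const])
    have "(\<lambda>n. m + 1 / real (Suc n)) \<longlonglongrightarrow> m + 0"
      using LIMSEQ_inverse_real_of_nat by (intro tendsto_intros) (simp add: inverse_eq_divide)
    then show "(\<lambda>n. m + 1 / real (Suc n)) \<longlonglongrightarrow> m" by simp
  qed (use y m_le in \<open>auto intro!: always_eventually simp: less_imp_le\<close>)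
  have *: ?thesis if "strict_mono r" "convergent (y \<circ> r)" for r :: "nat \<Rightarrow> nat"
    using LIMSEQ_subseq_LIMSEQ[OF lim that(1)] that(2) y
    by (intro minimum_attaining_of_convergent[OF M(2) T, of "y \<circ> r"]) (auto simp: o_def m_def)
  show ?thesis
  proof (cases "m = \<alpha>")
    case False
    then show ?thesis
      using modulus_minimizing_convergent_subsequence[OF M(1) T False m0 lower y(1,2) lim] * by blast
  next
    case True
    show ?thesis
    proof (cases "\<exists>x\<in>M. F x = 0 \<and> x \<noteq> 0")
      case True
      then obtain x where x: "x \<in> M" "F x = 0" "x \<noteq> 0" by blast
      \<comment> \<open>On the kernel of \<open>F\<close> the modulus is \<alpha> I - K, a map of
        norm at most \<open>\<alpha> = m\<close>; so any such vector of \<open>M\<close>, once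
        normalized, attains the minimum.\<close>
      have "norm (\<alpha> *\<^sub>R x - K x) \<le> \<alpha> * norm x"
        using AM_decompositionD(2,3) AM_decomposition_K_le
        by (intro positive_operator_contraction(1))
      then have "norm (T x) \<le> m * norm x"
        using x(2) \<open>m = \<alpha>\<close> by (simp add: norm_T_eq_modulus)
      then have "norm (T ((1 / norm x) *\<^sub>R x)) = m"
        using lower[OF x(1)] x(3) by (simp add: T.scaleR field_simps)
      then show ?thesis
        using unit[OF x(1)] x(3)
        by (auto simp: minimum_attaining_on_def m_def intro!: bexI[of _ "(1 / norm x) *\<^sub>R x"])
    next
      case False
      then show ?thesis
        using kernel_free_subspace_convergent_subsequence[OF M(1) _ y(1,2), of "\<lambda>n. n"] *
        by (auto simp: o_def)
    qed
  qed
qed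

text \<open>\<open>K x\<close> and \<open>F x\<close> are orthogonal since \<open>K\<close> is
  symmetric and annihilates \<open>F x\<close>. Thus K + F is the absolute value of K - F, and the
  latter determines both summands.\<close>

lemma modulus_K_F_sum_diff: "norm (K x + F x) = norm (K x - F x)"
proof -
  have "inner (K x) (F x) = 0"
    using AM_decompositionD(7)[of x] positive_operator_inner_commute[OF AM_decompositionD(3), of x "F x"]
    by simp
  then have "(norm (K x + F x))\<^sup>2 = (norm (K x - F x))\<^sup>2"
    by (simp add: power2_norm_eq_inner inner_simps inner_commute)
  then show ?thesis by simp
qed

text \<open>The space splits into the closure of the range of the modulus, where agreement extends
  by continuity, and its orthocomplement, the null space of the modulus, where both maps
  vanish.\<close>

lemma AM_decomposition_partial_isometry_eqI:
  assumes W: "bounded_clinear W" "\<And>x. W (modulus x) = V (modulus x)" "\<And>x. modulus x = 0 \<Longrightarrow> W x = 0"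
  shows "W = V"
proof
  fix x
  have lP: "bounded_linear modulus" by (rule bounded_clinear_bounded_linear[OF modulus_bounded_clinear])
  have lW: "bounded_linear W" and lV: "bounded_linear V"
    using W(1) AM_decompositionD(9) by (auto simp: bounded_clinear_def partial_isometry_def)
  let ?R = "closure (range modulus)"
  have "csubspace (range modulus)" by (rule csubspace_range[OF modulus_bounded_clinear])
  then have "subspace ?R" by (intro subspace_closure csubspace_subspace)
  then obtain p where p: "p \<in> ?R" "\<And>y. y \<in> ?R \<Longrightarrow> inner (x - p) y = 0"
    using projection_exists[of ?R x] by auto
  have "inner (modulus (x - p)) y = 0" for y
    using p(2)[of "modulus y"] closure_subset[of "range modulus"] modulus_inner_commute[of "x - p" y] by auto
  then have "modulus (x - p) = 0" by (metis inner_eq_zero_iff)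
  then have "W (x - p) = 0" "V (x - p) = 0" using W(3) AM_decompositionD(10) by auto
  moreover have "W p = V p"
  proof -
    have "closed {z. W z = V z}"
      by (intro closed_Collect_eq linear_continuous_on lW lV)
    moreover have "range modulus \<subseteq> {z. W z = V z}" using W(2) by auto
    ultimately have "?R \<subseteq> {z. W z = V z}" by (intro closure_minimal)
    then show ?thesis using p(1) by blast
  qed
  ultimately show "W x = V x"
    by (simp add: linear_simps(2)[OF lW] linear_simps(2)[OF lV])
qed

end

text \<open>The data are recovered in turn: the modulus from the norms \<open>norm (T x)\<close>;
  \<alpha> because \<open>(\<alpha> - \<alpha>') *\<^sub>R x\<close> is a compact map of
  \<open>x\<close>; then K - F, its absolute value K + F, and finally \<open>V\<close>.\<close>

lemma AM_decomposition_unique: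
  fixes T :: "'a::chilbert_space \<Rightarrow> 'b::chilbert_space"
  assumes inf: "\<not> cfinite_dim (UNIV :: 'a set)"
    and d: "AM_decomposition T V \<alpha> K F" and d': "AM_decomposition T V' \<alpha>' K' F'"
  shows "V = V' \<and> \<alpha> = \<alpha>' \<and> K = K' \<and> F = F'"
proof -
  define P where "P x = \<alpha> *\<^sub>R x - K x + F x" for x
  define P' where "P' x = \<alpha>' *\<^sub>R x - K' x + F' x" for x
  note P = bounded_clinear_bounded_linear[OF modulus_bounded_clinear[OF d]]
    modulus_inner_commute[OF d] modulus_inner_nonneg[OF d]
  note P' = bounded_clinear_bounded_linear[OF modulus_bounded_clinear[OF d']]
    modulus_inner_commute[OF d'] modulus_inner_nonneg[OF d']
  have "norm (P x) = norm (P' x)" for x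
    unfolding P_def P'_def norm_T_eq_modulus[OF d, symmetric] norm_T_eq_modulus[OF d', symmetric] ..
  then have PP': "P = P'"
    using P P' unfolding P_def P'_def by (intro positive_symmetric_eq_of_norm_eq)
  then have eq: "\<alpha> *\<^sub>R x - K x + F x = \<alpha>' *\<^sub>R x - K' x + F' x" for x
    by (simp add: P_def P'_def fun_eq_iff)
  have "seq_compact_map (\<lambda>x. (K x - F x) - (K' x - F' x))"
    by (intro seq_compact_map_diff AM_decomposition_seq_compact[OF d]
        AM_decomposition_seq_compact[OF d'])
  moreover have "(K x - F x) - (K' x - F' x) = (\<alpha> - \<alpha>') *\<^sub>R x" for x
    using eq[of x] by (simp add: algebra_simps)
  ultimately have "\<alpha> - \<alpha>' = 0"
    by (intro seq_compact_map_scaleR_imp_0[OF inf]) simp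
  then have \<alpha>: "\<alpha> = \<alpha>'" by simp
  have KF: "K x - F x = K' x - F' x" for x using eq[of x] \<alpha> by (simp add: algebra_simps)
  note pos = AM_decompositionD(3,5)[OF d] AM_decompositionD(3,5)[OF d']
  note lin = pos[THEN positive_operator_bounded_clinear, THEN bounded_clinear_bounded_linear]
  have "(\<lambda>x. K x + F x) = (\<lambda>x. K' x + F' x)"
  proof (rule positive_symmetric_eq_of_norm_eq)
    show "norm (K x + F x) = norm (K' x + F' x)" for x
      using modulus_K_F_sum_diff[OF d, of x] modulus_K_F_sum_diff[OF d', of x] KF by simp
    show "inner (K x + F x) x \<ge> 0" "inner (K' x + F' x) x \<ge> 0" for x
      using pos by (simp_all add: inner_add_left positive_operator_inner_nonneg)
  qed (use lin pos in
      \<open>simp_all add: bounded_linear_add inner_simps positive_operator_inner_commute\<close>)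
  then have sum: "K x + F x = K' x + F' x" for x by (simp add: fun_eq_iff)
  have "K x = K' x" "F x = F' x" for x
  proof -
    have "(K x + F x) + (K x - F x) = (K' x + F' x) + (K' x - F' x)"
      by (simp only: KF sum)
    then have "2 *\<^sub>R K x = 2 *\<^sub>R K' x" by (simp add: scaleR_2)
    then show "K x = K' x" by simp
    then show "F x = F' x" using sum[of x] by simp
  qed
  then have KF: "K = K'" "F = F'" by (simp_all add: fun_eq_iff)
  have "V' = V"
  proof (rule AM_decomposition_partial_isometry_eqI[OF d])
    show "bounded_clinear V'" using AM_decompositionD(9)[OF d'] by (simp add: partial_isometry_def)
    show "V' (\<alpha> *\<^sub>R x - K x + F x) = V (\<alpha> *\<^sub>R x - K x + F x)" for x
      using AM_decompositionD(1)[OF d, of x] AM_decompositionD(1)[OF d', of x] \<alpha> KF by simp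
    show "V' x = 0" if "\<alpha> *\<^sub>R x - K x + F x = 0" for x
      using AM_decompositionD(10)[OF d'] that \<alpha> KF by simp
  qed
  then show ?thesis using \<alpha> KF by simp
qed

subsection \<open>Spectral structure of absolutely minimum attaining operators\<close>

text \<open>First-order condition for a minimum at \<open>t = 0\<close>: otherwise a small step
  against the sign of \<open>b\<close> makes the expression negative.\<close>

lemma quadratic_nonneg_imp_linear_zero:
  assumes "\<And>t :: real. 0 \<le> 2 * t * b + t\<^sup>2 * c"
  shows "b = 0"
proof (rule ccontr)
  assume b: "b \<noteq> 0"
  \<comment> \<open>Positive and at least \<open>c\<close>, so at \<open>t = - (b / d)\<close> the
    quadratic is at most \<open>- (b\<^sup>2 / d)\<close>.\<close>
  define d where "d = \<bar>c\<bar> + 1"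
  have d: "d > 0" "c \<le> d" by (auto simp: d_def)
  have "(b / d)\<^sup>2 * c \<le> (b / d)\<^sup>2 * d" using d(2) by (intro mult_left_mono) auto
  also have "\<dots> = b\<^sup>2 / d" using d(1) by (simp add: power2_eq_square)
  finally have "2 * (- (b / d)) * b + (- (b / d))\<^sup>2 * c \<le> - (b\<^sup>2 / d)"
    by (simp add: power2_eq_square)
  moreover have "b\<^sup>2 / d > 0" using b d(1) by simp
  ultimately show False using assms[of "- (b / d)"] by linarith
qed

lemma cortho_complement_Un: "cortho_complement (A \<union> B) = cortho_complement A \<inter> cortho_complement B"
  by (auto simp: cortho_complement_def)

lemma cortho_complement_antimono: "A \<subseteq> B \<Longrightarrow> cortho_complement B \<subseteq> cortho_complement A"
  by (auto simp: cortho_complement_def)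

lemma cortho_complementD: "x \<in> cortho_complement A \<Longrightarrow> a \<in> A \<Longrightarrow> cinner x a = 0"
  by (simp add: cortho_complement_def)

lemma cortho_complementD': "x \<in> cortho_complement A \<Longrightarrow> a \<in> A \<Longrightarrow> cinner a x = 0"
  using cinner_commute[of a x] by (simp add: cortho_complement_def)

lemma cortho_complement_self_zero: "x \<in> A \<Longrightarrow> x \<in> cortho_complement A \<Longrightarrow> x = 0"
  using cortho_complementD cinner_eq_0_self by blast

context
  fixes T :: "'a::chilbert_space \<Rightarrow> 'b::chilbert_space" and S :: "'a \<Rightarrow> 'a"
  assumes AM: "absolutely_minimum_attaining T"
    and S: "\<And>x y. cinner (S x) y = cinner (T x) (T y)"
begin

lemma T_clinear: "bounded_clinear T"
  using AM by (simp add: absolutely_minimum_attaining_def)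

lemma T_simps: "T (x + y) = T x + T y" "T (x - y) = T x - T y"
    "T (c *\<^sub>C x) = c *\<^sub>C T x" "T (r *\<^sub>R x) = r *\<^sub>R T x"
  using linear_simps[OF bounded_clinear_bounded_linear[OF T_clinear]]
    bounded_clinear_scaleC[OF T_clinear] by auto

lemma S_commute: "cinner (S x) y = cinner x (S y)"
  using cinner_commute[of x "S y"] cinner_commute[of "T x" "T y"] by (simp add: S)

text \<open>Linearity of \<open>S\<close> is not among the hypotheses; testing against every
  \<open>v\<close> derives it from the defining identity.\<close>

lemma S_eqI: "(\<And>v. cinner y v = cinner (S x) v) \<Longrightarrow> S x = y"
  using cinner_eq_0_self[of "S x - y"] by (simp add: cinner_diff_left)

lemma S_simps: "S (x + y) = S x + S y" "S (x - y) = S x - S y" "S (r *\<^sub>R x) = r *\<^sub>R S x"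
  by (rule S_eqI; simp add: cinner_simps S T_simps)+

lemma S_eq_0_iff: "S x = 0 \<longleftrightarrow> T x = 0"
proof
  assume "S x = 0"
  then have "cinner (T x) (T x) = 0" using S[of x x] by simp
  then show "T x = 0" by (simp add: cinner_eq_0_self)
next
  assume "T x = 0"
  then have "cinner (S x) (S x) = 0" by (simp add: S)
  then show "S x = 0" by (simp add: cinner_eq_0_self)
qed

lemma minimizer_exists:
  assumes M: "csubspace M" "closed M" "M \<noteq> {0}"
  shows "\<exists>x\<in>M. norm x = 1 \<and> (\<forall>y\<in>M. norm (T x) * norm y \<le> norm (T y))"
proof -
  obtain x where x: "x \<in> M" "norm x = 1" "norm (T x) = min_modulus_on M T"
    using AM M unfolding absolutely_minimum_attaining_def minimum_attaining_on_def by blast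
  have "norm (T x) * norm y \<le> norm (T y)" if y: "y \<in> M" for y
  proof (cases "y = 0")
    case False
    have "bdd_below {norm (T x) |x. x \<in> M \<and> norm x = 1}" by (rule bdd_belowI[of _ 0]) auto
    moreover have "(1 / norm y) *\<^sub>R y \<in> M" using csubspace_scaleR[OF M(1) y] .
    ultimately have "min_modulus_on M T \<le> norm (T ((1 / norm y) *\<^sub>R y))"
      unfolding min_modulus_on_def using False
      by (intro cInf_lower) (auto intro!: exI[of _ "(1 / norm y) *\<^sub>R y"])
    then show ?thesis using False x(3) by (simp add: T_simps field_simps)
  qed simp
  with x show ?thesis by blast
qed

text \<open>The form \<open>(norm (T y))\<^sup>2 - (norm (T x))\<^sup>2 * (norm y)\<^sup>2\<close>
  is nonnegative on \<open>M\<close> and vanishes at \<open>x\<close>, so its first variation at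
  \<open>x\<close> vanishes in every direction of \<open>M\<close>.\<close>

lemma minimizer_cinner:
  assumes M: "csubspace M" and x: "x \<in> M" "norm x = 1"
    and min: "\<And>y. y \<in> M \<Longrightarrow> norm (T x) * norm y \<le> norm (T y)" and y: "y \<in> M"
  shows "cinner (T x) (T y) = of_real ((norm (T x))\<^sup>2) * cinner x y"
proof -
  define m where "m = norm (T x)"
  have re: "inner (T x) (T y) = m\<^sup>2 * inner x y" if y: "y \<in> M" for y
  proof -
    have "0 \<le> 2 * t * (inner (T x) (T y) - m\<^sup>2 * inner x y) + t\<^sup>2 * ((norm (T y))\<^sup>2 - m\<^sup>2 * (norm y)\<^sup>2)"
      for t
    proof -
      have "x + t *\<^sub>R y \<in> M" using M x(1) y by (simp add: csubspace_add csubspace_scaleR)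
      then have "m * norm (x + t *\<^sub>R y) \<le> norm (T (x + t *\<^sub>R y))" unfolding m_def by (rule min)
      then have "(m * norm (x + t *\<^sub>R y))\<^sup>2 \<le> (norm (T (x + t *\<^sub>R y)))\<^sup>2"
        by (intro power_mono) (auto simp: m_def)
      moreover have "(norm (T (x + t *\<^sub>R y)))\<^sup>2 = m\<^sup>2 + 2 * t * inner (T x) (T y) + t\<^sup>2 * (norm (T y))\<^sup>2"
        by (simp add: m_def T_simps power2_norm_eq_inner inner_simps inner_commute
            power2_eq_square[of t] algebra_simps)
      moreover have "(norm (x + t *\<^sub>R y))\<^sup>2 = (norm x)\<^sup>2 + 2 * t * inner x y + t\<^sup>2 * (norm y)\<^sup>2"
        by (simp add: power2_norm_eq_inner inner_simps inner_commute
            power2_eq_square[of t] algebra_simps)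
      ultimately show ?thesis by (simp add: power_mult_distrib x(2) algebra_simps)
    qed
    from quadratic_nonneg_imp_linear_zero[OF this] show ?thesis by simp
  qed
  show ?thesis
    using re[OF y] re[OF csubspace_scaleC[OF M y, of \<i>]]
    by (simp add: complex_eq_iff Im_cinner T_simps m_def flip: inner_eq_Re_cinner of_real_power)
qed

text \<open>The eigenvalue of \<open>S\<close> at a unit vector \<open>x\<close> must equal
  \<open>cinner (S x) x\<close>, which is \<open>(norm (T x))\<^sup>2\<close>; it is therefore
  written out instead of quantified.\<close>

definition eigenvec :: "'a \<Rightarrow> bool"
  where "eigenvec x \<longleftrightarrow> norm x = 1 \<and> S x = (norm (T x))\<^sup>2 *\<^sub>R x"

lemma eigenvec_exists:
  assumes W: "csubspace W" "closed W" "W \<noteq> {0}" and inv: "\<And>x. x \<in> W \<Longrightarrow> S x \<in> W"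
  shows "\<exists>x\<in>W. eigenvec x \<and> (\<forall>y\<in>W. (norm (T x))\<^sup>2 * (norm y)\<^sup>2 \<le> (norm (T y))\<^sup>2)"
proof -
  obtain x where x: "x \<in> W" "norm x = 1" "\<And>y. y \<in> W \<Longrightarrow> norm (T x) * norm y \<le> norm (T y)"
    using minimizer_exists[OF W] by blast
  define z where "z = S x - (norm (T x))\<^sup>2 *\<^sub>R x"
  have "z \<in> W" unfolding z_def using W(1) inv x(1) by (simp add: csubspace_diff csubspace_scaleR)
  \<comment> \<open>The residual \<open>z\<close> lies in \<open>W\<close> by invariance, while the
    first-order condition makes it orthogonal to all of \<open>W\<close>.\<close>
  then have "cinner z z = 0"
    using minimizer_cinner[OF W(1) x, of z]
    by (subst (1) z_def) (simp add: cinner_simps S)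
  then have "S x = (norm (T x))\<^sup>2 *\<^sub>R x" by (simp add: cinner_eq_0_self z_def)
  moreover have "(norm (T x))\<^sup>2 * (norm y)\<^sup>2 \<le> (norm (T y))\<^sup>2" if "y \<in> W" for y
    using power_mono[OF x(3)[OF that], of 2] by (simp add: power_mult_distrib)
  ultimately show ?thesis using x(1,2) by (auto simp: eigenvec_def)
qed

lemma S_invariant_cortho_complement:
  assumes A: "\<And>a. a \<in> A \<Longrightarrow> \<exists>c. S a = c *\<^sub>R a" and x: "x \<in> cortho_complement A"
  shows "S x \<in> cortho_complement A"
proof -
  have "cinner (S x) a = 0" if a: "a \<in> A" for a
  proof -
    obtain c where "S a = c *\<^sub>R a" using A[OF a] by blast
    then show ?thesis using cortho_complementD[OF x a] by (simp add: S_commute cinner_scaleR_right)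
  qed
  then show ?thesis by (simp add: cortho_complement_def)
qed

text \<open>Unit vectors \<open>g n = a n e n + b n f n\<close> can be chosen with \<open>\<parallel>T (g n)\<parallel>\<^sup>2 = t n\<close> strictly
  decreasing. A minimizer on their closed span \<open>M\<close> would be orthogonal to every \<open>g n\<close>.
  Taking \<open>M\<close> to be the double orthocomplement avoids any expansion in the \<open>g n\<close>.\<close>

lemma no_eigenvec_sequences:
  fixes e f :: "nat \<Rightarrow> 'a"
  assumes e: "corthonormal UNIV e" "\<And>n. eigenvec (e n)" "\<And>n. (norm (T (e n)))\<^sup>2 \<le> \<beta>"
    and f: "corthonormal UNIV f" "\<And>n. eigenvec (f n)" "\<And>n. (norm (T (f n)))\<^sup>2 > \<beta>"
    and ef: "\<And>n. f n \<in> cortho_complement (range e)"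
  shows False
proof -
  define l where "l n = (norm (T (e n)))\<^sup>2" for n
  define \<mu> where "\<mu> n = (norm (T (f n)))\<^sup>2" for n
  \<comment> \<open>Running minima of the gaps of the upper eigenvalues above \<beta>: positive,
    nonincreasing, and at most each gap so far.\<close>
  define d where "d n = Min ((\<lambda>i. \<mu> i - \<beta>) ` {..n})" for n
  \<comment> \<open>The growing denominator makes \<open>t\<close> strictly decreasing; starting it
    at 2 keeps \<open>t n\<close> strictly below \<open>\<mu> n\<close> even for
    \<open>n = 0\<close>.\<close>
  define t where "t n = \<beta> + d n / real (n + 2)" for n
  have d_pos: "d n > 0" for n
    using f(3) by (auto simp: d_def \<mu>_def)
  have d_le: "d n \<le> \<mu> n - \<beta>" and d_mono: "d (Suc n) \<le> d n" for n
    unfolding d_def by (auto intro!: Min_antimono)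
  have t_dec: "t (Suc n) < t n" for n
  proof -
    have "d (Suc n) / real (Suc n + 2) < d (Suc n) / real (n + 2)"
      using d_pos by (intro divide_strict_left_mono) auto
    also have "\<dots> \<le> d n / real (n + 2)" using d_mono by (intro divide_right_mono) auto
    finally show ?thesis by (simp add: t_def)
  qed
  have t_gt: "\<beta> < t n" for n using d_pos by (simp add: t_def)
  have t_lt: "t n < \<mu> n" for n
  proof -
    have "d n / real (n + 2) < d n / 1"
      using d_pos by (intro divide_strict_left_mono) auto
    then show ?thesis using d_le[of n] by (simp add: t_def)
  qed
  have l: "l n \<le> \<beta>" for n using e(3) by (simp add: l_def)
  \<comment> \<open>The squares of \<open>a n\<close> and \<open>b n\<close> are the weights of the
    convex combination of \<open>l n\<close> and \<open>\<mu> n\<close> that equals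
    \<open>t n\<close>.\<close>
  define b where "b n = sqrt ((t n - l n) / (\<mu> n - l n))" for n
  define a where "a n = sqrt ((\<mu> n - t n) / (\<mu> n - l n))" for n
  have pos: "t n - l n > 0" "\<mu> n - t n > 0" "\<mu> n - l n > 0" for n
    using t_gt[of n] t_lt[of n] l[of n] by linarith+
  have sq: "(a n)\<^sup>2 = (\<mu> n - t n) / (\<mu> n - l n)" "(b n)\<^sup>2 = (t n - l n) / (\<mu> n - l n)" for n
    using pos[of n] by (simp_all add: a_def b_def)
  have ab: "(a n)\<^sup>2 + (b n)\<^sup>2 = 1" for n
    unfolding sq add_divide_distrib[symmetric] using pos(3)[of n] by simp
  have abt: "(a n)\<^sup>2 * l n + (b n)\<^sup>2 * \<mu> n = t n" for n
  proof -
    have "(\<mu> n - t n) * l n + (t n - l n) * \<mu> n = t n * (\<mu> n - l n)" by (simp add: algebra_simps)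
    then show ?thesis
      using pos(3)[of n] by (simp add: sq add_divide_distrib[symmetric])
  qed
  define g where "g n = a n *\<^sub>R e n + b n *\<^sub>R f n" for n
  have oe: "cinner (e m) (e n) = of_bool (m = n)" and off: "cinner (f m) (f n) = of_bool (m = n)"
    and oef: "cinner (e m) (f n) = 0" "cinner (f n) (e m) = 0" for m n
    using e(1) f(1) cortho_complementD[OF ef] cortho_complementD'[OF ef]
    by (auto simp: corthonormal_def)
  have Sg: "S (g n) = (a n * l n) *\<^sub>R e n + (b n * \<mu> n) *\<^sub>R f n" for n
    using e(2)[of n] f(2)[of n] by (simp add: g_def S_simps eigenvec_def l_def \<mu>_def)
  have og: "cinner (g m) (g n) = of_bool (m = n)" for m n
  proof -
    have "cinner (g m) (g n) = of_bool (m = n) * of_real ((a n)\<^sup>2 + (b n)\<^sup>2)"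
      by (simp add: g_def cinner_simps oe off oef power2_eq_square)
    then show ?thesis by (simp only: ab) simp
  qed
  have oSg: "cinner (S (g m)) (g n) = of_bool (m = n) * of_real (t n)" for m n
  proof -
    have "cinner (S (g m)) (g n) = of_bool (m = n) * of_real ((a n)\<^sup>2 * l n + (b n)\<^sup>2 * \<mu> n)"
      unfolding Sg by (simp add: g_def cinner_simps oe off oef power2_eq_square algebra_simps)
    then show ?thesis by (simp only: abt)
  qed
  define M where "M = cortho_complement (cortho_complement (range g))"
  have M: "csubspace M" "closed M"
    unfolding M_def by (rule csubspace_cortho_complement closed_cortho_complement)+
  have gM: "g n \<in> M" for n
    unfolding M_def using cortho_complementD'[of _ "range g" "g n"]
    by (subst cortho_complement_def) auto
  have ng: "norm (g n) = 1" for n using corthonormal_norm[of UNIV g n] og by (simp add: corthonormal_def)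
  then have "g 0 \<noteq> 0" by (metis norm_zero zero_neq_one)
  then have "M \<noteq> {0}" using gM[of 0] by auto
  then obtain x where x: "x \<in> M" "norm x = 1" "\<And>y. y \<in> M \<Longrightarrow> norm (T x) * norm y \<le> norm (T y)"
    using minimizer_exists[OF M] by blast
  have Tg: "(norm (T (g n)))\<^sup>2 = t n" for n
  proof -
    have "complex_of_real ((norm (T (g n)))\<^sup>2) = of_real (t n)"
      using oSg[of n n] S[of "g n" "g n"] by (simp add: cinner_self)
    then show ?thesis using of_real_eq_iff by blast
  qed
  have le: "(norm (T x))\<^sup>2 \<le> t n" for n
    using power_mono[OF x(3)[OF gM[of n]], of 2] ng Tg by simp
  have "cinner x (g n) = 0" for n
  proof -
    \<comment> \<open>\<open>g n\<close> need not be an eigenvector of \<open>S\<close>, but it is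
      one for the compression of \<open>S\<close> to \<open>M\<close>, with eigenvalue
      \<open>t n\<close>; that is all a vector \<open>x\<close> of \<open>M\<close> sees.\<close>
    have "S (g n) - t n *\<^sub>R g n \<in> cortho_complement (range g)"
      by (auto simp: cortho_complement_def cinner_simps oSg og)
    then have "cinner x (S (g n) - t n *\<^sub>R g n) = 0"
      using x(1) unfolding M_def by (rule cortho_complementD[rotated])
    then have "cinner (T x) (T (g n)) = of_real (t n) * cinner x (g n)"
      by (simp add: cinner_simps flip: S_commute S)
    moreover have "cinner (T x) (T (g n)) = of_real ((norm (T x))\<^sup>2) * cinner x (g n)"
      by (rule minimizer_cinner[OF M(1) x gM])
    \<comment> \<open>The minimum is at most the next term \<open>t (Suc n)\<close>, hence strictly
      below \<open>t n\<close>; two different factors then force the inner product to be 0.\<close>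
    moreover have "(norm (T x))\<^sup>2 \<noteq> t n" using le[of "Suc n"] t_dec[of n] by simp
    ultimately show ?thesis by (metis mult_right_cancel of_real_eq_iff)
  qed
  then have "x \<in> cortho_complement (range g)" by (auto simp: cortho_complement_def)
  then have "x = 0" using x(1) cortho_complement_self_zero unfolding M_def by blast
  then show False using x(2) by simp
qed

text \<open>The space is exhausted by three orthogonal pieces: the sequence \<open>e\<close> of
  successive minimizers with limit eigenvalue \<beta>, a finite maximal set \<open>A\<close> of
  eigenvectors above \<beta>, and the part \<open>Z\<close> of the \<beta>-eigenspace orthogonal to
  both. A nonzero remainder would contain one more eigenvector, and no eigenvalue is left for
  it.\<close>

lemma spectral_structure:
  assumes inf: "\<not> cfinite_dim (UNIV :: 'a set)"
  obtains g :: "nat \<Rightarrow> 'a" and s \<beta> where "corthonormal UNIV g"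
    "\<And>n. S (g n) = s n *\<^sub>R g n" "\<And>n. s n \<ge> 0" "s \<longlonglongrightarrow> \<beta>" "finite {n. s n > \<beta>}"
    "\<And>x. x \<in> cortho_complement (range g) \<Longrightarrow> S x = \<beta> *\<^sub>R x"
proof -
  let ?N = "\<lambda>x. (norm (T x))\<^sup>2"
  have "\<exists>e. \<forall>n::nat. (corthonormal (e ` {..<n}) (\<lambda>x. x) \<and> (\<forall>a\<in>e ` {..<n}. eigenvec a)) \<and>
    (e n \<in> cortho_complement (e ` {..<n}) \<and> eigenvec (e n) \<and>
      (\<forall>y\<in>cortho_complement (e ` {..<n}). ?N (e n) * (norm y)\<^sup>2 \<le> ?N y))"
  proof (rule greedy_sequence[where P = "\<lambda>A. corthonormal A (\<lambda>x. x) \<and> (\<forall>a\<in>A. eigenvec a)"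
      and Q = "\<lambda>A x. x \<in> cortho_complement A \<and> eigenvec x \<and>
        (\<forall>y\<in>cortho_complement A. ?N x * (norm y)\<^sup>2 \<le> ?N y)"])
    fix A :: "'a set" assume A: "finite A" "corthonormal A (\<lambda>x. x) \<and> (\<forall>a\<in>A. eigenvec a)"
    have "cortho_complement A \<noteq> {0}"
      using unit_vector_cortho_complement[OF inf A(1)] A(2)
      by (metis norm_zero singletonD zero_neq_one)
    moreover have "S x \<in> cortho_complement A" if "x \<in> cortho_complement A" for x
      by (rule S_invariant_cortho_complement[OF _ that]) (use A(2) eigenvec_def in blast)
    ultimately obtain x where "x \<in> cortho_complement A" "eigenvec x"
      "\<forall>y\<in>cortho_complement A. ?N x * (norm y)\<^sup>2 \<le> ?N y"
      using eigenvec_exists[OF csubspace_cortho_complement closed_cortho_complement] by meson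
    moreover from this have "corthonormal (insert x A) (\<lambda>x. x)"
      using A(2) by (intro corthonormal_insert) (auto simp: eigenvec_def)
    ultimately show "\<exists>x. (x \<in> cortho_complement A \<and> eigenvec x \<and>
        (\<forall>y\<in>cortho_complement A. ?N x * (norm y)\<^sup>2 \<le> ?N y)) \<and>
        corthonormal (insert x A) (\<lambda>x. x) \<and> (\<forall>a\<in>insert x A. eigenvec a)"
      using A(2) by blast
  qed (simp add: corthonormal_def)
  then obtain e :: "nat \<Rightarrow> 'a" where e: "\<And>n. e n \<in> cortho_complement (e ` {..<n})"
    "\<And>n. eigenvec (e n)"
    and e_min: "\<And>n y. y \<in> cortho_complement (e ` {..<n}) \<Longrightarrow> ?N (e n) * (norm y)\<^sup>2 \<le> ?N y"
    by blast
  have one: "norm (e n) = 1" for n using e(2) by (simp add: eigenvec_def)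
  have oe: "corthonormal UNIV e" by (rule corthonormal_nat[OF one e(1)])
  define l where "l n = ?N (e n)" for n
  \<comment> \<open>Each later minimizer already competed in the larger orthocomplement of the
    previous stage.\<close>
  have "l n \<le> l (Suc n)" for n
  proof -
    have "e (Suc n) \<in> cortho_complement (e ` {..<n})"
      using e(1)[of "Suc n"] cortho_complement_antimono[of "e ` {..<n}" "e ` {..<Suc n}"]
      by (auto simp: lessThan_Suc)
    then show ?thesis using e_min[of "e (Suc n)" n] one by (simp add: l_def)
  qed
  then have "incseq l" by (rule incseq_SucI)
  moreover have "l n \<le> (onorm T)\<^sup>2" for n
    using onorm[OF bounded_clinear_bounded_linear[OF T_clinear], of "e n"] one
    by (auto simp: l_def intro!: power_mono)
  ultimately obtain \<beta> where \<beta>: "l \<longlonglongrightarrow> \<beta>" "\<And>n. l n \<le> \<beta>"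
    using incseq_convergent[of l "(onorm T)\<^sup>2"] by auto
  have lower: "\<beta> * (norm y)\<^sup>2 \<le> ?N y" if y: "y \<in> cortho_complement (range e)" for y
  proof (rule LIMSEQ_le_const2)
    show "(\<lambda>n. l n * (norm y)\<^sup>2) \<longlonglongrightarrow> \<beta> * (norm y)\<^sup>2" by (intro tendsto_intros \<beta>)
    have "y \<in> cortho_complement (e ` {..<n})" for n
      using y cortho_complement_antimono[of "e ` {..<n}" "range e"] by auto
    then show "\<exists>N. \<forall>n\<ge>N. l n * (norm y)\<^sup>2 \<le> ?N y" using e_min by (auto simp: l_def)
  qed
  define R where "R a \<longleftrightarrow> eigenvec a \<and> ?N a > \<beta> \<and> a \<in> cortho_complement (range e)" for a
  have "\<exists>A. finite A \<and> corthonormal A (\<lambda>x. x) \<and> (\<forall>a\<in>A. R a) \<and> \<not> (\<exists>x\<in>cortho_complement A. R x)"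
  proof (rule ccontr)
    assume neg: "\<not> ?thesis"
    \<comment> \<open>Without a finite maximal set the choice never stops and produces the second
      sequence excluded by \<open>no_eigenvec_sequences\<close>.\<close>
    have "\<exists>f. \<forall>n::nat. (corthonormal (f ` {..<n}) (\<lambda>x. x) \<and> (\<forall>a\<in>f ` {..<n}. R a)) \<and>
      (f n \<in> cortho_complement (f ` {..<n}) \<and> R (f n))"
    proof (rule greedy_sequence[where P = "\<lambda>A. corthonormal A (\<lambda>x. x) \<and> (\<forall>a\<in>A. R a)"
        and Q = "\<lambda>A x. x \<in> cortho_complement A \<and> R x"])
      fix A :: "'a set" assume A: "finite A" "corthonormal A (\<lambda>x. x) \<and> (\<forall>a\<in>A. R a)"
      with neg obtain x where x: "x \<in> cortho_complement A" "R x" by blast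
      then have "corthonormal (insert x A) (\<lambda>x. x)"
        using A(2) by (intro corthonormal_insert) (auto simp: R_def eigenvec_def)
      with x A(2) show "\<exists>x. (x \<in> cortho_complement A \<and> R x) \<and>
          corthonormal (insert x A) (\<lambda>x. x) \<and> (\<forall>a\<in>insert x A. R a)" by blast
    qed (simp add: corthonormal_def)
    then obtain f :: "nat \<Rightarrow> 'a" where f: "\<And>n. f n \<in> cortho_complement (f ` {..<n})" "\<And>n. R (f n)"
      by blast
    have "norm (f n) = 1" for n using f(2) by (simp add: R_def eigenvec_def)
    then have "corthonormal UNIV f" using f(1) by (rule corthonormal_nat)
    then show False
      using f(2) e(2) \<beta>(2) oe unfolding R_def l_def by (intro no_eigenvec_sequences[of e \<beta> f]) auto
  qed
  then obtain A where A: "finite A" "corthonormal A (\<lambda>x. x)" "\<And>a. a \<in> A \<Longrightarrow> R a"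
    and max: "\<And>x. x \<in> cortho_complement A \<Longrightarrow> \<not> R x" by blast
  \<comment> \<open>Since \<open>S\<close> is symmetric, its \<beta>-eigenspace is the
    orthocomplement of the range of S - \<beta> I. In this form \<open>Z\<close> is visibly a closed
    subspace.\<close>
  define Z where "Z = cortho_complement (range e \<union> A \<union> range (\<lambda>y. S y - \<beta> *\<^sub>R y))"
  have SZ: "S x = \<beta> *\<^sub>R x \<longleftrightarrow> x \<in> cortho_complement (range (\<lambda>y. S y - \<beta> *\<^sub>R y))" for x
  proof -
    have "cinner x (S y - \<beta> *\<^sub>R y) = cinner (S x - \<beta> *\<^sub>R x) y" for y
      by (simp add: cinner_simps S_commute)
    then show ?thesis
      using cinner_eq_0_self[of "S x - \<beta> *\<^sub>R x"] by (auto simp: cortho_complement_def)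
  qed
  define W where "W = cortho_complement (range e \<union> A \<union> Z)"
  have "W = {0}"
  proof (rule ccontr)
    assume "W \<noteq> {0}"
    moreover have "\<exists>c. S a = c *\<^sub>R a" if "a \<in> range e \<union> A \<union> Z" for a
      using that e(2) A(3) SZ[of a] by (auto simp: R_def eigenvec_def Z_def cortho_complement_Un)
    then have "S x \<in> W" if "x \<in> W" for x
      using that unfolding W_def by (intro S_invariant_cortho_complement)
    ultimately obtain x where x: "x \<in> W" "eigenvec x"
      using eigenvec_exists[of W] csubspace_cortho_complement closed_cortho_complement
      unfolding W_def by metis
    then have xs: "x \<in> cortho_complement (range e)" "x \<in> cortho_complement A" "x \<in> cortho_complement Z"
      by (auto simp: W_def cortho_complement_Un)
    have nx: "norm x = 1" "S x = ?N x *\<^sub>R x" using x(2) by (auto simp: eigenvec_def)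
    \<comment> \<open>Maximality of \<open>A\<close> excludes eigenvalues above \<beta> and
      \<open>lower\<close> those below; the eigenvalue \<beta> puts \<open>x\<close> into
      \<open>Z\<close>, to which it is orthogonal.\<close>
    have "\<not> ?N x > \<beta>" using max[OF xs(2)] xs(1) x(2) by (auto simp: R_def)
    then have "?N x = \<beta>" using lower[OF xs(1)] nx(1) by simp
    then have "x \<in> Z" using nx(2) xs SZ by (simp add: Z_def cortho_complement_Un)
    then have "x = 0" using xs(3) cortho_complement_self_zero by blast
    then show False using nx(1) by simp
  qed
  have rest: "S x = \<beta> *\<^sub>R x" if x: "x \<in> cortho_complement (range e \<union> A)" for x
  proof -
    have "csubspace Z" "closed Z"
      unfolding Z_def by (rule csubspace_cortho_complement closed_cortho_complement)+
    then obtain z where z: "z \<in> Z" "x - z \<in> cortho_complement Z"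
      by (rule csubspace_projection_exists)
    have "z \<in> cortho_complement (range e \<union> A)"
      using z(1) by (simp add: Z_def cortho_complement_Un)
    then have "x - z \<in> cortho_complement (range e \<union> A)"
      using x csubspace_diff[OF csubspace_cortho_complement] by blast
    then have "x - z \<in> W" using z(2) by (simp add: W_def cortho_complement_Un)
    then have "x = z" using \<open>W = {0}\<close> by simp
    then show ?thesis using z(1) SZ by (simp add: Z_def cortho_complement_Un)
  qed
  define N where "N = card A"
  obtain h where h: "bij_betw h {0..<N} A"
    unfolding N_def using ex_bij_betw_nat_finite[OF A(1)] by blast
  \<comment> \<open>The finitely many vectors of \<open>A\<close> come first; shifting
    \<open>e\<close> by \<open>N\<close> does not affect the limit, and only the first
    \<open>N\<close> eigenvalues can exceed \<beta>.\<close>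
  define g where "g n = (if n < N then h n else e (n - N))" for n
  have hA: "h n \<in> A" if "n < N" for n using h that by (auto simp: bij_betw_def)
  have gev: "eigenvec (g n)" for n
    using e(2) A(3)[OF hA] by (auto simp: g_def R_def)
  have range_g: "range g = range e \<union> A"
  proof
    show "range g \<subseteq> range e \<union> A" using hA by (auto simp: g_def)
    have "e n \<in> range g" for n using rangeI[of g "n + N"] by (simp add: g_def)
    moreover have "a \<in> range g" if a: "a \<in> A" for a
    proof -
      obtain n where "n < N" "h n = a" using h a by (auto simp: bij_betw_def)
      then show ?thesis using rangeI[of g n] by (simp add: g_def)
    qed
    ultimately show "range e \<union> A \<subseteq> range g" by auto
  qed
  have "corthonormal UNIV g"
    unfolding corthonormal_def
  proof (intro ballI)
    fix m n
    have hh: "cinner (h m) (h n) = of_bool (m = n)" if "m < N" "n < N"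
      using corthonormalD[OF A(2) hA[OF that(1)] hA[OF that(2)]] h that
      by (auto simp: bij_betw_def inj_on_def)
    have he: "cinner (h i) (e j) = 0" "cinner (e j) (h i) = 0" if "i < N" for i j
      using A(3)[OF hA[OF that]] cortho_complementD cortho_complementD' unfolding R_def by blast+
    show "cinner (g m) (g n) = of_bool (m = n)"
      using hh he corthonormalD[OF oe] by (auto simp: g_def)
  qed
  moreover have "S (g n) = ?N (g n) *\<^sub>R g n" for n using gev by (simp add: eigenvec_def)
  moreover have "(\<lambda>n. ?N (g n)) \<longlonglongrightarrow> \<beta>"
  proof (rule LIMSEQ_offset[of _ N])
    show "(\<lambda>n. ?N (g (n + N))) \<longlonglongrightarrow> \<beta>" using \<beta>(1) by (simp add: g_def l_def[abs_def])
  qed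
  moreover have "finite {n. ?N (g n) > \<beta>}"
  proof (rule finite_subset)
    have "n < N" if "?N (g n) > \<beta>" for n
      using that \<beta>(2)[of "n - N"] by (auto simp: g_def l_def split: if_splits)
    then show "{n. ?N (g n) > \<beta>} \<subseteq> {..<N}" by auto
  qed simp
  moreover have "S x = \<beta> *\<^sub>R x" if "x \<in> cortho_complement (range g)" for x
    using rest that by (simp add: range_g)
  ultimately show thesis using that[of g "\<lambda>n. ?N (g n)" \<beta>] by simp
qed

end

section \<open>Assembling the decomposition from the spectral data\<close>

lemma diag_op_eq_0_iff:
  assumes g: "corthonormal UNIV g" and c: "Bseq c"
  shows "diag_op g c \<gamma> x = 0 \<longleftrightarrow>
    (\<forall>n. c n = 0 \<or> cinner x (g n) = 0) \<and>
    (\<forall>v\<in>cortho_complement (range g). \<gamma> = 0 \<or> cinner x v = 0)"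
proof
  assume 0: "diag_op g c \<gamma> x = 0"
  show "(\<forall>n. c n = 0 \<or> cinner x (g n) = 0) \<and>
    (\<forall>v\<in>cortho_complement (range g). \<gamma> = 0 \<or> cinner x v = 0)"
    using cinner_diag_op_basis[OF g c, of \<gamma> x] cinner_diag_op_cortho[OF g c, of _ \<gamma> x]
    unfolding 0 by simp
next
  assume "(\<forall>n. c n = 0 \<or> cinner x (g n) = 0) \<and>
    (\<forall>v\<in>cortho_complement (range g). \<gamma> = 0 \<or> cinner x v = 0)"
  then show "diag_op g c \<gamma> x = 0"
    by (intro diag_ext[OF g])
      (auto simp: cinner_diag_op_basis[OF g c] cinner_diag_op_cortho[OF g c])
qed

lemma positive_operator_diag_op_0:
  assumes "corthonormal UNIV g" "Bseq c" "\<And>n. c n \<ge> 0"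
  shows "positive_operator (diag_op g c 0)"
  unfolding positive_operator_def
  by (intro conjI allI bounded_clinear_diag_op cinner_diag_op_0_nonneg cadjoint_symmetric
      cinner_diag_op_commute assms)

text \<open>For \<open>a = 0\<close> the convention \<open>inverse 0 = 0\<close> is essential: all
  but finitely many \<open>p n\<close> are then exactly 0. This keeps the eigenvalues of the
  pseudo-inverse convergent.\<close>

lemma tendsto_inverse_of_eventually_le:
  fixes p :: "nat \<Rightarrow> real"
  assumes "p \<longlonglongrightarrow> a" "\<And>n. p n \<ge> 0" "finite {n. p n > a}"
  shows "(\<lambda>n. inverse (p n)) \<longlonglongrightarrow> inverse a"
proof (cases "a = 0")
  case True
  have "eventually (\<lambda>n. n \<notin> {n. p n > a}) sequentially"
    using assms(3) unfolding cofinite_eq_sequentially[symmetric] eventually_cofinite by simp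
  then have "eventually (\<lambda>n. inverse (p n) = inverse a) sequentially"
    by eventually_elim (use assms(2) True in \<open>auto intro: antisym\<close>)
  then show ?thesis by (rule tendsto_eventually)
qed (use assms in \<open>auto intro: tendsto_inverse\<close>)

lemma absolutely_minimum_attaining_decomposition:
  fixes T :: "'a::chilbert_space \<Rightarrow> 'b::chilbert_space"
  assumes inf: "\<not> cfinite_dim (UNIV :: 'a set)"
    and AM: "absolutely_minimum_attaining T"
  shows "\<exists>V \<alpha> K F. AM_decomposition T V \<alpha> K F"
proof -
  have T: "bounded_clinear T" using AM by (simp add: absolutely_minimum_attaining_def)
  obtain S where S: "\<And>x y. cinner (S x) y = cinner (T x) (T y)"
    using gram_operator_exists[OF T] by blast
  obtain g :: "nat \<Rightarrow> 'a" and s \<beta> where g: "corthonormal UNIV g"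
    and s: "\<And>n. S (g n) = s n *\<^sub>R g n" "\<And>n. s n \<ge> 0" "s \<longlonglongrightarrow> \<beta>" "finite {n. s n > \<beta>}"
    and rest: "\<And>x. x \<in> cortho_complement (range g) \<Longrightarrow> S x = \<beta> *\<^sub>R x"
    using spectral_structure[OF AM S inf] by metis
  have \<beta>0: "\<beta> \<ge> 0" using LIMSEQ_le_const[OF s(3)] s(2) by blast
  define p where "p n = sqrt (s n)" for n
  define \<alpha> where "\<alpha> = sqrt \<beta>"
  \<comment> \<open>Eigenvalues of the pseudo-inverse of the modulus; a zero eigenvalue stays 0
    because \<open>inverse 0 = 0\<close>.\<close>
  define q where "q n = inverse (p n)" for n
  \<comment> \<open>\<open>k\<close> and \<open>f\<close> are the negative and positive parts of
    \<open>p - \<alpha>\<close>: their products vanish, \<open>p n = \<alpha> - k n + f n\<close>,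
    and \<open>f\<close> has finite support because only finitely many \<open>p n\<close> exceed
    \<alpha>.\<close>
  define k where "k n = max (\<alpha> - p n) 0" for n
  define f where "f n = max (p n - \<alpha>) 0" for n
  have \<alpha>0: "\<alpha> \<ge> 0" and p0: "p n \<ge> 0" for n using \<beta>0 s(2) by (auto simp: \<alpha>_def p_def)
  have p: "p \<longlonglongrightarrow> \<alpha>" unfolding p_def \<alpha>_def by (intro tendsto_intros s)
  have fin: "finite {n. p n > \<alpha>}" using s(4) by (simp add: p_def \<alpha>_def)
  have q: "q \<longlonglongrightarrow> inverse \<alpha>"
    unfolding q_def by (rule tendsto_inverse_of_eventually_le[OF p p0 fin])
  have k: "k \<longlonglongrightarrow> 0" unfolding k_def using tendsto_max[OF tendsto_diff[OF tendsto_const[of \<alpha>] p] tendsto_const[of 0]] by simp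
  have f: "f \<longlonglongrightarrow> 0" unfolding f_def using tendsto_max[OF tendsto_diff[OF p tendsto_const[of \<alpha>]] tendsto_const[of 0]] by simp
  have B: "Bseq p" "Bseq q" "Bseq k" "Bseq f" "Bseq s"
    using p q k f s(3) by (auto intro!: convergent_imp_Bseq convergentI)
  define P Q K F where "P = diag_op g p \<alpha>" and "Q = diag_op g q (inverse \<alpha>)"
    and "K = diag_op g k 0" and "F = diag_op g f 0"
  define V where "V = T \<circ> Q"
  have P_eq: "P = (\<lambda>x. \<alpha> *\<^sub>R x - K x + F x)"
  proof
    fix x
    have "p n = \<alpha> - k n + f n" for n by (simp add: k_def f_def)
    then have pc: "complex_of_real (p n) = of_real \<alpha> - of_real (k n) + of_real (f n)" for n
      by (metis of_real_add of_real_diff)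
    show "P x = \<alpha> *\<^sub>R x - K x + F x"
      unfolding P_def K_def F_def
      by (rule diag_ext[OF g]) (simp_all add: cinner_simps cinner_diag_op_basis[OF g]
          cinner_diag_op_cortho[OF g] B pc algebra_simps)
  qed
  have S_eq: "S x = diag_op g s \<beta> x" for x
    by (rule diag_ext[OF g])
      (simp_all add: cinner_diag_op_basis[OF g] cinner_diag_op_cortho[OF g] B
        S_commute[OF AM S] s(1) rest cinner_simps)
  have pp: "p n * p n = s n" for n using s(2) by (simp add: p_def)
  have aa: "\<alpha> * \<alpha> = \<beta>" using \<beta>0 by (simp add: \<alpha>_def)
  \<comment> \<open>QP is the orthogonal projection away from the kernel of \<open>S\<close>, so
    \<open>S\<close> does not notice it.\<close>
  have SQP: "S (Q (P x)) = S x" for x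
  proof -
    have "s n * (q n * p n) = s n" for n unfolding pp[symmetric] q_def by (cases "p n = 0") auto
    moreover have "\<beta> * (inverse \<alpha> * \<alpha>) = \<beta>" unfolding aa[symmetric] by (cases "\<alpha> = 0") auto
    ultimately have "diag_op g (\<lambda>n. s n * (q n * p n)) (\<beta> * (inverse \<alpha> * \<alpha>)) x = diag_op g s \<beta> x"
      by presburger
    then show ?thesis
      by (simp only: S_eq P_def Q_def diag_op_compose[OF g] B Bseq_mult)
  qed
  have TQP: "T (Q (P x)) = T x" for x
  proof -
    have "S (Q (P x) - x) = 0"
      by (simp add: S_simps[OF AM S] SQP)
    then show ?thesis using S_eq_0_iff[OF AM S] T_simps(2)[OF AM S] by simp
  qed
  have V_null: "V x = 0 \<longleftrightarrow> P x = 0" for x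
  proof -
    have "V x = 0 \<longleftrightarrow> diag_op g (\<lambda>n. s n * q n) (\<beta> * inverse \<alpha>) x = 0"
      by (simp add: V_def S_eq Q_def diag_op_compose[OF g] B flip: S_eq_0_iff[OF AM S])
    moreover have "s n * q n = p n" for n unfolding pp[symmetric] q_def by (cases "p n = 0") auto
    moreover have "\<beta> * inverse \<alpha> = \<alpha>" unfolding aa[symmetric] by (cases "\<alpha> = 0") auto
    ultimately show ?thesis by (simp add: P_def)
  qed
  have V_isometric: "norm (V x) = norm x" if x: "x \<in> cortho_complement (null_space V)" for x
  proof -
    have kern: "cinner x z = 0" if "P z = 0" for z
      using x that V_null by (auto simp: cortho_complement_def null_space_def)
    \<comment> \<open>QSQ is the projection onto the orthocomplement of the null space of
      \<open>P\<close>, where \<open>x\<close> lies. Symmetry of \<open>Q\<close> then turns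
      \<open>cinner (V x) (V x)\<close> into \<open>cinner x x\<close>.\<close>
    have "Q (S (Q x)) = x"
    proof (rule diag_ext[OF g])
      show "cinner (Q (S (Q x))) (g n) = cinner x (g n)" for n
      proof (cases "p n = 0")
        case True
        have "P (g n) = 0"
          using True corthonormalD[OF g, of n] unfolding P_def diag_op_eq_0_iff[OF g B(1)]
          by (auto simp: cortho_complementD')
        then have "cinner x (g n) = 0" by (rule kern)
        then show ?thesis by (simp add: Q_def S_eq cinner_diag_op_basis[OF g] B)
      next
        case False
        then have "q n * (s n * q n) = 1" unfolding pp[symmetric] q_def by (simp add: field_simps)
        then have "complex_of_real (q n) * (of_real (s n) * of_real (q n)) = 1"
          by (metis of_real_1 of_real_mult)
        then show ?thesis by (simp add: Q_def S_eq cinner_diag_op_basis[OF g] B mult.assoc flip: mult.assoc)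
      qed
      show "cinner (Q (S (Q x))) v = cinner x v" if v: "v \<in> cortho_complement (range g)" for v
      proof (cases "\<alpha> = 0")
        case True
        have "P v = 0"
          using True v unfolding P_def diag_op_eq_0_iff[OF g B(1)] by (auto simp: cortho_complementD)
        then have "cinner x v = 0" by (rule kern)
        then show ?thesis by (simp add: Q_def S_eq cinner_diag_op_cortho[OF g] B v)
      next
        case False
        then show ?thesis
          by (simp add: Q_def S_eq cinner_diag_op_cortho[OF g] B v flip: aa)
      qed
    qed
    then have "cinner (V x) (V x) = cinner x x"
      using cinner_diag_op_commute[OF g B(2), of "inverse \<alpha>" "S (Q x)" x]
      by (simp add: V_def Q_def flip: S)
    then show ?thesis by (metis cinner_self norm_ge_zero of_real_eq_iff power2_eq_iff_nonneg)
  qed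
  have "bounded_clinear V"
    using T bounded_clinear_diag_op[OF g B(2), of "inverse \<alpha>"]
    unfolding V_def Q_def bounded_clinear_def o_def by (simp add: bounded_linear_compose)
  then have V: "partial_isometry V" using V_isometric by (simp add: partial_isometry_def)
  have "onorm K \<le> \<alpha>"
    unfolding K_def using \<alpha>0 p0 by (intro onorm_bound norm_diag_op_0_le[OF g]) (auto simp: k_def)
  moreover have "K (F x) = 0" "F (K x) = 0" for x
  proof -
    have "k n * f n = 0" "f n * k n = 0" for n by (auto simp: k_def f_def max_def)
    then have "(\<lambda>n. k n * f n) = (\<lambda>n. 0)" "(\<lambda>n. f n * k n) = (\<lambda>n. 0)" by (simp_all only:)
    then show "K (F x) = 0" "F (K x) = 0"
      by (simp_all only: K_def F_def diag_op_compose[OF g] B mult_zero_left diag_op_zero)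
  qed
  moreover have "finite_rank_operator F"
    unfolding F_def using fin
    by (intro finite_rank_operator_diag_op_0[OF g]) (auto simp: f_def max_def elim!: rev_finite_subset)
  moreover have "T = V \<circ> (\<lambda>x. \<alpha> *\<^sub>R x - K x + F x)"
    using TQP unfolding P_eq[symmetric] by (auto simp: V_def fun_eq_iff)
  moreover have "null_space V = null_space (\<lambda>x. \<alpha> *\<^sub>R x - K x + F x)"
    using V_null unfolding P_eq[symmetric] by (auto simp: null_space_def)
  moreover have "positive_operator K" "positive_operator F"
    unfolding K_def F_def using B by (auto intro!: positive_operator_diag_op_0[OF g] simp: k_def f_def)
  moreover have "compact_operator K" unfolding K_def by (rule compact_operator_diag_op_0[OF g k])
  ultimately have "AM_decomposition T V \<alpha> K F"
    unfolding AM_decomposition_def using \<alpha>0 V by (simp add: fun_eq_iff)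
  then show ?thesis by blast
qed

theorem theorem5p25:
  fixes T :: "'a::chilbert_space \<Rightarrow> 'b::chilbert_space"
  assumes "\<not> cfinite_dim (UNIV :: 'a set)"
    and "\<not> cfinite_dim (UNIV :: 'b set)"
    and "bounded_clinear T"
  shows "(absolutely_minimum_attaining T \<longleftrightarrow> (\<exists>V \<alpha> K F. AM_decomposition T V \<alpha> K F)) \<and>
    (\<forall>V \<alpha> K F V' \<alpha>' K' F'. AM_decomposition T V \<alpha> K F \<and> AM_decomposition T V' \<alpha>' K' F' \<longrightarrow>
      V = V' \<and> \<alpha> = \<alpha>' \<and> K = K' \<and> F = F')"
proof -
  have "absolutely_minimum_attaining T" if "AM_decomposition T V \<alpha> K F" for V \<alpha> K F
    using AM_decomposition_minimum_attaining[OF that] assms(3)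
    by (auto simp: absolutely_minimum_attaining_def bounded_clinear_bounded_linear)
  then show ?thesis
    using absolutely_minimum_attaining_decomposition[OF assms(1)]
      AM_decomposition_unique[OF assms(1)] by blast
qed

end
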